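(* Let $G, H\in\mathcal{RH}_\infty^{m\times m}$, where $G(s)=\mathrm{diag}\{G_1(s),\dots,G_N(s)\}$ is block-diagonal with square blocks $G_i(s)$, and where $H(s)=H\succ 0$ is a constant positive definite matrix. The closed-loop system $G(s)\#H(s)$ is stable if, for each $\omega\in[0,\infty)$, at least one of the following three conditions holds: 1) (decentralized gain condition) $\max_i \overline{\sigma}(G_i(j\omega)) < \underline{\sigma}(H^{-1})$; 2) (decentralized phase condition) every $G_i(j\omega)$ is sectorial, and a) $\max_i \overline{\phi}(G_i(j\omega)) < \pi$, b) $\min_i \underline{\phi}(G_i(j\omega)) > -\pi$, and c) $\max_i \overline{\phi}(G_i(j\omega)) - \min_i \underline{\phi}(G_i(j\omega)) < \pi$; 3) (decentralized $x$-$z$ graph separation) for every $i\in\{1,\dots,N\}$, $$P(G_i(j\omega))\cap P\!\left(-\tfrac{1}{\tau}H^{-1}\right)=\varnothing\quad\text{for all }\tau\in(0,1].$$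
   Context: $\mathcal{RH}_\infty^{m\times m}$ is the set of real, rational, proper, stable $m\times m$ transfer function matrices. For $G,H\in\mathcal{RH}_\infty^{m\times m}$, the standard (negative) feedback interconnection is described by $$G\#H=\begin{bmatrix}(I+HG)^{-1} & (I+HG)^{-1}H\\ G(I+HG)^{-1} & G(I+HG)^{-1}H\end{bmatrix},$$ and the closed-loop system is called stable if $G\#H\in\mathcal{RH}_\infty^{2m\times 2m}$. For a complex matrix $A\in\mathbb{C}^{n\times n}$: $\overline\sigma(A)$ and $\underline\sigma(A)$ are the largest and smallest singular values. The numerical range is $W(A)=\{x^*Ax: x\in\mathbb{C}^n,\|x\|=1\}$ (Euclidean norm). $A$ is sectorial if $0\notin W(A)$. A sectorial $A$ has a decomposition $A=T^*DT$ with $T$ nonsingular and $D$ diagonal unitary, $D$ unique up to permutation and with all diagonal entries on an arc of the unit circle of length smaller than $\pi$. The phases $\overline\phi(A)=\phi_1(A)\ge\dots\ge\phi_n(A)=\underline\phi(A)$ are the arguments of the diagonal entries of $D$, chosen so that $\overline\phi(A)-\underline\phi(A)<\pi$, with the usual convention (fixing the common multiple of $2\pi$) that $\tfrac12(\overline\phi(A)+\underline\phi(A))\in(-\pi,\pi]$. The $x$-$z$ graph of $A\in\mathbb{C}^{n\times n}$ is $$P(A)=\{(\Re(x^*Ax),\|Ax\|^2): x\in\mathbb{C}^n,\|x\|=1\}\subset\mathbb{R}^2,$$ i.e. the projection onto the $x$-$z$ plane of the Davis-Wielandt shell $DW(A)=\{(x^*Ax,\|Ax\|^2): x\in\mathbb{C}^n,\|x\|=1\}\subset\mathbb{C}\times\mathbb{R}$,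 with $\mathbb{C}$ identified with the $x$-$y$ plane. Sets $P(A)$ and $P(B)$ may be compared for matrices of different sizes.
   Formalization: One of the three conditions is also required at ω = ∞, for the limits G_i(∞); with only ω in [0,∞) the claim fails, e.g. for G(s) = -2s/(s+1), H = 1, where (1+HG)^{-1} = (1+s)/(1-s) is unstable. *)

theory Defs
  imports
    "HOL.Complex"
    "HOL-Computational_Algebra.Field_as_Ring"
    "HOL-Computational_Algebra.Polynomial_Factorial"
    "HOL-Computational_Algebra.Normalized_Fraction"
    "Jordan_Normal_Form.Schur_Decomposition"
    "Jordan_Normal_Form.Gauss_Jordan_Elimination"
begin

section \<open>Transfer functions\<close>

text \<open>
  Real rational functions are elements of the fraction field of the real polynomials.
  All notions below refer to the reduced representation, so that poles are not
  confused with cancelled factors.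
\<close>

type_synonym tf = "real poly fract"
type_synonym tf_mat = "real poly fract mat"

definition tf_num :: "tf \<Rightarrow> real poly" where
  "tf_num f = fst (quot_of_fract f)"

definition tf_den :: "tf \<Rightarrow> real poly" where
  "tf_den f = snd (quot_of_fract f)"

definition tf_proper :: "tf \<Rightarrow> bool" where
  "tf_proper f \<longleftrightarrow> degree (tf_num f) \<le> degree (tf_den f)"

definition tf_stable :: "tf \<Rightarrow> bool" where
  "tf_stable f \<longleftrightarrow> (\<forall>s. Re s \<ge> 0 \<longrightarrow> poly (map_poly complex_of_real (tf_den f)) s \<noteq> 0)"

definition RH_inf :: "nat \<Rightarrow> nat \<Rightarrow> tf_mat set" where
  "RH_inf m n = {F \<in> carrier_mat m n.
     \<forall>i<m. \<forall>j<n. tf_proper (F $$ (i, j)) \<and> tf_stable (F $$ (i, j))}"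

definition tf_eval :: "tf \<Rightarrow> complex \<Rightarrow> complex" where
  "tf_eval f s = poly (map_poly complex_of_real (tf_num f)) s
               / poly (map_poly complex_of_real (tf_den f)) s"

text \<open>The limit as \<open>s\<close> tends to infinity of a proper transfer function.\<close>

definition tf_at_infinity :: "tf \<Rightarrow> complex" where
  "tf_at_infinity f =
     complex_of_real (coeff (tf_num f) (degree (tf_den f)) / lead_coeff (tf_den f))"

definition freq_response :: "tf_mat \<Rightarrow> real \<Rightarrow> complex mat" where
  "freq_response F \<omega> = map_mat (\<lambda>f. tf_eval f (\<i> * complex_of_real \<omega>)) F"

text \<open>
  The value at \<open>\<omega> = \<infinity>\<close>. Frequency conditions have to cover the closed half-line
  \<open>[0, \<infinity>]\<close>: for \<open>G = - 2 s / (s + 1)\<close> and \<open>H = 1\<close> the gain condition holds at \<open>\<omega> = 0\<close> and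
  the phase condition at every finite \<open>\<omega> > 0\<close>, all conditions fail at \<open>\<omega> = \<infinity>\<close>, and
  \<open>1 / (1 + H G) = (1 + s) / (1 - s)\<close> is unstable.
\<close>

definition freq_response_infinity :: "tf_mat \<Rightarrow> complex mat" where
  "freq_response_infinity F = map_mat tf_at_infinity F"

definition const_tf_mat :: "real mat \<Rightarrow> tf_mat" where
  "const_tf_mat A = map_mat (\<lambda>c. to_fract [:c:]) A"

section \<open>Feedback interconnection\<close>

text \<open>Only meaningful for invertible matrices.\<close>

definition mat_inv :: "'a::field mat \<Rightarrow> 'a mat" where
  "mat_inv A = the (mat_inverse A)"

definition feedback :: "tf_mat \<Rightarrow> tf_mat \<Rightarrow> tf_mat" where
  "feedback G H =
     (let S = mat_inv (1\<^sub>m (dim_row G) + H * G)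
      in four_block_mat S (S * H) (G * S) (G * S * H))"

text \<open>
  The interconnection exists as a matrix of rational functions only if \<open>I + H G\<close> is
  invertible over the field of rational functions.
\<close>

definition feedback_stable :: "nat \<Rightarrow> tf_mat \<Rightarrow> tf_mat \<Rightarrow> bool" where
  "feedback_stable m G H \<longleftrightarrow>
     invertible_mat (1\<^sub>m m + H * G) \<and> feedback G H \<in> RH_inf (2 * m) (2 * m)"

section \<open>Singular values, numerical range, phases and x-z graphs of square matrices\<close>

definition positive_definite :: "real mat \<Rightarrow> bool" where
  "positive_definite A \<longleftrightarrow> square_mat A \<and> transpose_mat A = A \<and>
     (\<forall>x \<in> carrier_vec (dim_row A). x \<noteq> 0\<^sub>v (dim_row A) \<longrightarrow> x \<bullet> (A *\<^sub>v x) > 0)"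

definition eucl_norm :: "complex vec \<Rightarrow> real" where
  "eucl_norm x = sqrt (\<Sum>i<dim_vec x. (cmod (x $ i))\<^sup>2)"

definition singular_values :: "complex mat \<Rightarrow> real set" where
  "singular_values A = {\<sigma>. \<sigma> \<ge> 0 \<and> eigenvalue (mat_adjoint A * A) (complex_of_real (\<sigma>\<^sup>2))}"

definition sigma_max :: "complex mat \<Rightarrow> real" where
  "sigma_max A = Max (singular_values A)"

definition sigma_min :: "complex mat \<Rightarrow> real" where
  "sigma_min A = Min (singular_values A)"

text \<open>\<open>u \<bullet>c v\<close> conjugates its second argument, so this is \<open>x\<^sup>* A x\<close>.\<close>

definition quad_form :: "complex mat \<Rightarrow> complex vec \<Rightarrow> complex" where
  "quad_form A x = (A *\<^sub>v x) \<bullet>c x"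

definition unit_vecs_of :: "nat \<Rightarrow> complex vec set" where
  "unit_vecs_of n = {x \<in> carrier_vec n. eucl_norm x = 1}"

definition numerical_range :: "complex mat \<Rightarrow> complex set" where
  "numerical_range A = quad_form A ` unit_vecs_of (dim_row A)"

definition sectorial :: "complex mat \<Rightarrow> bool" where
  "sectorial A \<longleftrightarrow> 0 \<notin> numerical_range A"

text \<open>
  \<open>\<phi>\<close> lists the phases of \<open>A\<close> in descending order: \<open>A = T\<^sup>* D T\<close> with \<open>T\<close> nonsingular and
  \<open>D\<close> the diagonal matrix with entries \<open>exp (\<i> \<phi>\<^sub>k)\<close>.
\<close>

definition is_phases :: "complex mat \<Rightarrow> real list \<Rightarrow> bool" where
  "is_phases A \<phi> \<longleftrightarrow>
     length \<phi> = dim_row A \<and> sorted_wrt (\<ge>) \<phi> \<and>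
     (\<exists>T \<in> carrier_mat (dim_row A) (dim_row A). invertible_mat T \<and>
        A = mat_adjoint T * mat_diag (dim_row A) (\<lambda>k. cis (\<phi> ! k)) * T) \<and>
     hd \<phi> - last \<phi> < pi \<and>
     - pi < (hd \<phi> + last \<phi>) / 2 \<and> (hd \<phi> + last \<phi>) / 2 \<le> pi"

text \<open>For a sectorial matrix of positive size there is exactly one such list.\<close>

definition phases :: "complex mat \<Rightarrow> real list" where
  "phases A = (SOME \<phi>. is_phases A \<phi>)"

definition phase_max :: "complex mat \<Rightarrow> real" where
  "phase_max A = hd (phases A)"

definition phase_min :: "complex mat \<Rightarrow> real" where
  "phase_min A = last (phases A)"

definition xz_graph :: "complex mat \<Rightarrow> (real \<times> real) set" where
  "xz_graph A = (\<lambda>x. (Re (quad_form A x), (eucl_norm (A *\<^sub>v x))\<^sup>2)) ` unit_vecs_of (dim_row A)"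

section \<open>The decentralized conditions at one frequency\<close>

text \<open>
  \<open>As\<close> is the list of the blocks, evaluated at the frequency in question.
\<close>

definition gain_condition :: "complex mat list \<Rightarrow> complex mat \<Rightarrow> bool" where
  "gain_condition As H \<longleftrightarrow> Max (sigma_max ` set As) < sigma_min (mat_inv H)"

definition phase_condition :: "complex mat list \<Rightarrow> bool" where
  "phase_condition As \<longleftrightarrow>
     (\<forall>A \<in> set As. sectorial A) \<and>
     Max (phase_max ` set As) < pi \<and>
     Min (phase_min ` set As) > - pi \<and>
     Max (phase_max ` set As) - Min (phase_min ` set As) < pi"

definition xz_condition :: "complex mat list \<Rightarrow> complex mat \<Rightarrow> bool" where
  "xz_condition As H \<longleftrightarrow>
     (\<forall>A \<in> set As. \<forall>\<tau>::real. 0 < \<tau> \<and> \<tau> \<le> 1 \<longrightarrow>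
        xz_graph A \<inter> xz_graph (complex_of_real (- (1 / \<tau>)) \<cdot>\<^sub>m mat_inv H) = {})"

end

theory Submission
  imports Defs
    "Jordan_Normal_Form.Spectral_Radius"
    "HOL-Analysis.Function_Topology"
    "HOL-Analysis.Convex_Euclidean_Space"
begin

text \<open>
  At each frequency every one of the three conditions yields a quadratic form
  \<open>a \<parallel>A x\<parallel>\<^sup>2 + Re (b x\<^sup>* A x) + c \<parallel>x\<parallel>\<^sup>2\<close> that is positive for every block \<open>A\<close> of \<open>G\<close> and nonpositive
  for \<open>A = - (1 / \<tau>) H\<^sup>-\<^sup>1\<close>. Such forms are additive over diagonal blocks, so \<open>I + \<tau> H G\<close> is nonsingular
  for all \<open>\<tau> \<in> [0, 1]\<close> on the imaginary axis and at infinity. Clearing denominators, \<open>det (I + \<tau> H G)\<close>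
  is a polynomial in \<open>s\<close> of constant degree without imaginary roots, which is stable for \<open>\<tau> = 0\<close>; hence
  it is stable for \<open>\<tau> = 1\<close>, and Cramer's rule puts \<open>(I + H G)\<^sup>-\<^sup>1\<close> into \<open>RH_inf\<close>.

  The form for the gain condition is \<open>\<sigma>\<^sup>2 \<parallel>x\<parallel>\<^sup>2 - \<parallel>A x\<parallel>\<^sup>2\<close> with \<open>\<sigma>\<close> the least singular value of \<open>H\<^sup>-\<^sup>1\<close>; for
  the phase condition it is \<open>Re (cis (- d) x\<^sup>* A x)\<close> with \<open>\<bar>d\<bar> \<le> \<pi> / 2\<close>. For the graph condition, with \<open>p\<close> and
  \<open>q\<close> the extreme eigenvalues of \<open>H\<^sup>-\<^sup>1\<close> and \<open>t = 1 / \<tau>\<close>, it is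
  \<open>\<parallel>A x\<parallel>\<^sup>2 + (p + q) t Re (x\<^sup>* A x) + p q t\<^sup>2 \<parallel>x\<parallel>\<^sup>2\<close>, from \<open>(H\<^sup>-\<^sup>1 - p I) (H\<^sup>-\<^sup>1 - q I) \<le> 0\<close>.
\<close>

hide_type (open) Finite_Cartesian_Product.vec
hide_const (open) Finite_Cartesian_Product.vec Finite_Cartesian_Product.mat Finite_Cartesian_Product.row
unbundle no inner_syntax and no vec_syntax

section \<open>Hermitian matrices\<close>

lemma mat_adjoint_dim [simp]:
  "dim_row (mat_adjoint A) = dim_col A" "dim_col (mat_adjoint A) = dim_row A"
  by (auto simp: mat_adjoint_def)

lemma mat_adjoint_carrier [simp]:
  "A \<in> carrier_mat n m \<Longrightarrow> mat_adjoint A \<in> carrier_mat m n"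
  by (auto intro!: carrier_matI)

lemma mat_adjoint_index [simp]:
  "i < dim_col A \<Longrightarrow> j < dim_row A \<Longrightarrow> mat_adjoint A $$ (i, j) = conjugate (A $$ (j, i))"
  by (auto simp: mat_adjoint_def mat_of_rows_index)

lemma mat_adjoint_adjoint [simp]: "mat_adjoint (mat_adjoint A) = (A :: complex mat)"
  by (rule eq_matI) auto

lemma mat_adjoint_one [simp]: "mat_adjoint (1\<^sub>m n) = (1\<^sub>m n :: complex mat)"
  by (rule eq_matI) auto

lemma mat_adjoint_mult:
  fixes A B :: "complex mat"
  assumes "dim_col A = dim_row B"
  shows "mat_adjoint (A * B) = mat_adjoint B * mat_adjoint A"
  using assms by (intro eq_matI) (auto simp: scalar_prod_def intro!: sum.cong)

lemma mat_adjoint_mat_diag: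
  "mat_adjoint (mat_diag n f) = mat_diag n (\<lambda>k. cnj (f k))"
  by (rule eq_matI) (auto simp: mat_diag_def)

lemma cscalar_prod_adjoint:
  fixes A :: "complex mat"
  assumes A: "A \<in> carrier_mat n m" and "x \<in> carrier_vec m" "y \<in> carrier_vec n"
  shows "(A *\<^sub>v x) \<bullet>c y = x \<bullet>c (mat_adjoint A *\<^sub>v y)"
proof -
  have "(A *\<^sub>v x) \<bullet>c y = (\<Sum>i<n. \<Sum>j<m. A $$ (i, j) * x $ j * cnj (y $ i))"
    using assms by (simp add: scalar_prod_def sum_distrib_right lessThan_atLeast0)
  also have "\<dots> = (\<Sum>j<m. \<Sum>i<n. A $$ (i, j) * x $ j * cnj (y $ i))"
    by (rule sum.swap)
  also have "\<dots> = x \<bullet>c (mat_adjoint A *\<^sub>v y)"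
    using assms by (simp add: scalar_prod_def sum_distrib_left lessThan_atLeast0 mult_ac)
  finally show ?thesis .
qed

lemma eucl_norm_square: "(eucl_norm x)\<^sup>2 = (\<Sum>i<dim_vec x. (cmod (x $ i))\<^sup>2)"
  by (simp add: eucl_norm_def sum_nonneg)

lemma cscalar_prod_self: "x \<bullet>c x = complex_of_real ((eucl_norm x)\<^sup>2)"
  unfolding eucl_norm_square
  by (simp add: scalar_prod_def lessThan_atLeast0 complex_norm_square del: of_real_power)

lemma eucl_norm_nonneg [simp]: "eucl_norm x \<ge> 0"
  by (simp add: eucl_norm_def sum_nonneg)

lemma eucl_norm_eq_0_iff: "x \<in> carrier_vec n \<Longrightarrow> eucl_norm x = 0 \<longleftrightarrow> x = 0\<^sub>v n"
  by (auto simp: eucl_norm_def sum_nonneg_eq_0_iff)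

lemma eucl_norm_pos_iff: "x \<in> carrier_vec n \<Longrightarrow> eucl_norm x > 0 \<longleftrightarrow> x \<noteq> 0\<^sub>v n"
  using eucl_norm_eq_0_iff[of x n] eucl_norm_nonneg[of x] by linarith

lemma eucl_norm_smult: "eucl_norm (c \<cdot>\<^sub>v x) = cmod c * eucl_norm x"
  by (simp add: eucl_norm_def norm_mult power_mult_distrib flip: sum_distrib_left)
     (simp add: real_sqrt_mult)

lemma mult_carrier_square [simp]:
  "A \<in> carrier_mat n n \<Longrightarrow> B \<in> carrier_mat n n \<Longrightarrow> A * B \<in> carrier_mat n n"
  by simp

lemma unitary_mult_adjoint:
  fixes U :: "complex mat"
  assumes "U \<in> carrier_mat n n" "mat_adjoint U * U = 1\<^sub>m n"
  shows "U * mat_adjoint U = 1\<^sub>m n"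
  using mat_mult_left_right_inverse[of "mat_adjoint U" n U] assms by simp

lemma unitary_eucl_norm:
  fixes U :: "complex mat"
  assumes U: "U \<in> carrier_mat n n" "mat_adjoint U * U = 1\<^sub>m n" and x: "x \<in> carrier_vec n"
  shows "eucl_norm (U *\<^sub>v x) = eucl_norm x"
proof -
  have "(U *\<^sub>v x) \<bullet>c (U *\<^sub>v x) = x \<bullet>c (mat_adjoint U *\<^sub>v (U *\<^sub>v x))"
    using U x by (intro cscalar_prod_adjoint[of U n n]) auto
  also have "mat_adjoint U *\<^sub>v (U *\<^sub>v x) = (mat_adjoint U * U) *\<^sub>v x"
    using U x by (intro assoc_mult_mat_vec[symmetric]) auto
  finally have "complex_of_real ((eucl_norm (U *\<^sub>v x))\<^sup>2) = complex_of_real ((eucl_norm x)\<^sup>2)"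
    using U x by (simp add: cscalar_prod_self)
  then show ?thesis by (simp only: of_real_eq_iff) (simp add: power2_eq_iff_nonneg)
qed

section \<open>The spectral theorem\<close>

text \<open>Gram-Schmidt applied to a basis starting with \<open>v\<close> keeps \<open>v\<close> as
  its first vector; dividing the orthogonal vectors by their norms gives the columns of
  \<open>W\<close>. Since \<open>v\<close> need not be a unit vector, the first column is only a
  nonzero multiple of it.\<close>

lemma unitary_completion:
  fixes v :: "complex vec"
  assumes v: "v \<in> carrier_vec n" "v \<noteq> 0\<^sub>v n"
  obtains W c where "W \<in> carrier_mat n n" "mat_adjoint W * W = 1\<^sub>m n" "c \<noteq> 0"
    "W *\<^sub>v unit_vec n 0 = c \<cdot>\<^sub>v v"
proof -
  interpret cof_vec_space n "TYPE(complex)" .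
  define b where "b = basis_completion v"
  define ws where "ws = gram_schmidt n b"
  note bc = basis_completion[OF v, folded b_def]
  have n: "n > 0" using v by (cases n) auto
  obtain vs where bv: "b = v # vs" using bc n by (cases b) auto
  have ws: "set ws \<subseteq> carrier_vec n" "corthogonal ws" "length ws = n"
    using gram_schmidt_result[OF bc(2,4,5) refl] bc(6) by (auto simp: ws_def)
  have hd: "ws ! 0 = v"
    using gram_schmidt_hd[OF v(1), of vs] n ws(3) by (cases ws) (auto simp: ws_def bv)
  have wsi: "ws ! i \<in> carrier_vec n" if "i < n" for i using ws that by auto
  define r where "r i = complex_of_real (1 / eucl_norm (ws ! i))" for i
  have wn: "eucl_norm (ws ! i) \<noteq> 0" if "i < n" for i
    using corthogonalD[OF ws(2), of i i] that ws(3) cscalar_prod_self[of "ws ! i"] by auto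
  define W where "W = mat n n (\<lambda>(i, j). r j * ws ! j $ i)"
  have W: "W \<in> carrier_mat n n" by (simp add: W_def)
  have "mat_adjoint W * W = 1\<^sub>m n"
  proof (rule eq_matI)
    fix i j assume "i < dim_row (1\<^sub>m n :: complex mat)" "j < dim_col (1\<^sub>m n :: complex mat)"
    then have ij: "i < n" "j < n" by auto
    have "(mat_adjoint W * W) $$ (i, j) = r i * r j * (ws ! j \<bullet>c ws ! i)"
      using ij W wsi[OF ij(1)] wsi[OF ij(2)]
      by (simp add: scalar_prod_def W_def sum_distrib_left r_def mult_ac)
    also have "\<dots> = (if i = j then 1 else 0)"
      using corthogonalD[OF ws(2), of j i] ij ws(3) wn[OF ij(1)]
      by (auto simp: cscalar_prod_self r_def power2_eq_square)
    finally show "(mat_adjoint W * W) $$ (i, j) = 1\<^sub>m n $$ (i, j)" using ij by simp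
  qed (use W in auto)
  moreover have "W *\<^sub>v unit_vec n 0 = r 0 \<cdot>\<^sub>v v"
    using n v hd by (intro eq_vecI) (auto simp: W_def)
  moreover have "r 0 \<noteq> 0" using wn[OF n] by (simp add: r_def)
  ultimately show thesis using that W by blast
qed

text \<open>Deflation by induction on the size: after a unitary change of basis whose first vector
  is an eigenvector, the first column is \<open>e\<close> times the first unit vector. Hermiticity
  clears the first row as well, so a hermitian block of size one less remains.\<close>

lemma hermitian_spectral:
  fixes A :: "complex mat"
  assumes "A \<in> carrier_mat n n" "mat_adjoint A = A"
  obtains U and l :: "nat \<Rightarrow> real" where "U \<in> carrier_mat n n" "mat_adjoint U * U = 1\<^sub>m n"
    "A = U * mat_diag n (\<lambda>k. complex_of_real (l k)) * mat_adjoint U"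
  using assms
proof (induction n arbitrary: A thesis)
  case 0
  show ?case
    by (rule "0.prems"(1)[of "1\<^sub>m 0" "\<lambda>_. 0"]) (use 0(2) in \<open>auto intro!: eq_matI\<close>)
next
  case (Suc n)
  note A = Suc.prems(2,3)
  obtain e where "eigenvalue A e"
    using spectrum_non_empty[OF A(1)] by (auto simp: spectrum_def)
  then obtain v where v: "v \<in> carrier_vec (Suc n)" "v \<noteq> 0\<^sub>v (Suc n)" "A *\<^sub>v v = e \<cdot>\<^sub>v v"
    using A(1) by (auto simp: eigenvalue_def eigenvector_def)
  obtain W c where W: "W \<in> carrier_mat (Suc n) (Suc n)" "mat_adjoint W * W = 1\<^sub>m (Suc n)" "c \<noteq> 0"
    and Wv: "W *\<^sub>v unit_vec (Suc n) 0 = c \<cdot>\<^sub>v v"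
    using unitary_completion[OF v(1,2)] by metis
  define B where "B = mat_adjoint W * A * W"
  have B: "B \<in> carrier_mat (Suc n) (Suc n)" using W A unfolding B_def by auto
  have WW: "W * mat_adjoint W = 1\<^sub>m (Suc n)" by (rule unitary_mult_adjoint[OF W(1,2)])
  have herm: "mat_adjoint B = B"
    using W A unfolding B_def by (simp add: mat_adjoint_mult)
      (rule assoc_mult_mat[of _ "Suc n" "Suc n" _ "Suc n" _ "Suc n", symmetric]; simp)
  have AB: "A = W * B * mat_adjoint W"
  proof -
    have "W * B * mat_adjoint W = (W * mat_adjoint W) * A * (W * mat_adjoint W)"
      using W A unfolding B_def
      by (simp add: assoc_mult_mat[of _ "Suc n" "Suc n" _ "Suc n" _ "Suc n"])
    then show ?thesis using WW A by simp
  qed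
  have Be: "B *\<^sub>v unit_vec (Suc n) 0 = e \<cdot>\<^sub>v unit_vec (Suc n) 0"
  proof -
    have "B *\<^sub>v unit_vec (Suc n) 0 = mat_adjoint W *\<^sub>v (A *\<^sub>v (W *\<^sub>v unit_vec (Suc n) 0))"
      using W A unfolding B_def
      by (simp add: assoc_mult_mat_vec[of _ "Suc n" "Suc n" _ "Suc n"])
    also have "A *\<^sub>v (W *\<^sub>v unit_vec (Suc n) 0) = e \<cdot>\<^sub>v (W *\<^sub>v unit_vec (Suc n) 0)"
      using A v unfolding Wv by (simp add: mult_mat_vec smult_smult_assoc mult.commute)
    also have "mat_adjoint W *\<^sub>v \<dots> = e \<cdot>\<^sub>v (mat_adjoint W *\<^sub>v (W *\<^sub>v unit_vec (Suc n) 0))"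
      using W by (simp add: mult_mat_vec[of _ "Suc n" "Suc n"])
    also have "mat_adjoint W *\<^sub>v (W *\<^sub>v unit_vec (Suc n) 0) = unit_vec (Suc n) 0"
      using W by (simp flip: assoc_mult_mat_vec[of _ "Suc n" "Suc n" _ "Suc n"])
    finally show ?thesis .
  qed
  have Bi0: "B $$ (i, 0) = (if i = 0 then e else 0)" if "i < Suc n" for i
    using arg_cong[OF Be, of "\<lambda>x. x $ i"] that B by (simp split: if_splits)
  have Bsym: "B $$ (i, j) = cnj (B $$ (j, i))" if "i < Suc n" "j < Suc n" for i j
    using arg_cong[OF herm, of "\<lambda>X. X $$ (i, j)"] that B by auto
  \<comment> \<open>Diagonal entries of a hermitian matrix are real, so the eigenvalue
    \<open>e\<close> may enter the real list as \<open>Re e\<close>.\<close>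
  have e: "cnj e = e" using Bsym[of 0 0] Bi0[of 0] by simp
  then have eR: "complex_of_real (Re e) = e" by (simp add: complex_eq_iff)
  define C where "C = mat n n (\<lambda>(i, j). B $$ (Suc i, Suc j))"
  have C: "C \<in> carrier_mat n n" by (simp add: C_def)
  have Cherm: "mat_adjoint C = C"
    by (rule eq_matI) (auto simp: C_def Bsym[symmetric])
  have B4: "B = four_block_mat (mat 1 1 (\<lambda>_. e)) (0\<^sub>m 1 n) (0\<^sub>m n 1) C"
  proof (rule eq_matI)
    fix i j assume "i < dim_row (four_block_mat (mat 1 1 (\<lambda>_. e)) (0\<^sub>m 1 n) (0\<^sub>m n 1) C)"
      "j < dim_col (four_block_mat (mat 1 1 (\<lambda>_. e)) (0\<^sub>m 1 n) (0\<^sub>m n 1) C)"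
    then have ij: "i < Suc n" "j < Suc n" using C by auto
    show "B $$ (i, j) = four_block_mat (mat 1 1 (\<lambda>_. e)) (0\<^sub>m 1 n) (0\<^sub>m n 1) C $$ (i, j)"
      using ij C Bi0[OF ij(1)] Bi0[OF ij(2)] Bsym[OF ij]
      by (cases i; cases j) (auto simp: C_def)
  qed (use B C in auto)
  obtain V and l :: "nat \<Rightarrow> real" where V: "V \<in> carrier_mat n n" "mat_adjoint V * V = 1\<^sub>m n"
    "C = V * mat_diag n (\<lambda>k. complex_of_real (l k)) * mat_adjoint V"
    using Suc.IH[OF _ C Cherm] by metis
  \<comment> \<open>\<open>V'\<close> leaves the first coordinate alone and diagonalizes the
    remaining block; the unitary matrix sought is \<open>W * V'\<close>.\<close>
  define V' where "V' = four_block_mat (1\<^sub>m 1) (0\<^sub>m 1 n) (0\<^sub>m n 1) V"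
  have V': "V' \<in> carrier_mat (Suc n) (Suc n)" using V by (auto simp: V'_def)
  have V'a: "mat_adjoint V' = four_block_mat (1\<^sub>m 1) (0\<^sub>m 1 n) (0\<^sub>m n 1) (mat_adjoint V)"
    using V by (intro eq_matI) (auto simp: V'_def)
  define l' where "l' = case_nat (Re e) l"
  have D4: "mat_diag (Suc n) (\<lambda>k. complex_of_real (l' k)) =
    four_block_mat (mat 1 1 (\<lambda>_. e)) (0\<^sub>m 1 n) (0\<^sub>m n 1) (mat_diag n (\<lambda>k. complex_of_real (l k)))"
    by (intro eq_matI) (auto simp: mat_diag_def l'_def eR split: nat.split)
  have V'V': "mat_adjoint V' * V' = 1\<^sub>m (Suc n)"
  proof -
    have "mat_adjoint V' * V' = four_block_mat (1\<^sub>m 1) (0\<^sub>m 1 n) (0\<^sub>m n 1) (1\<^sub>m n)"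
      unfolding V'a unfolding V'_def using V
      by (subst mult_four_block_mat[of _ 1 1 _ n _ n _ _ 1 _ n]) auto
    then show ?thesis by simp
  qed
  have e1: "mat 1 1 (\<lambda>_. e) * 1\<^sub>m 1 = mat 1 1 (\<lambda>_. e)" by auto
  have BV: "B = V' * mat_diag (Suc n) (\<lambda>k. complex_of_real (l' k)) * mat_adjoint V'"
  proof -
    have *: "V' * mat_diag (Suc n) (\<lambda>k. complex_of_real (l' k)) =
      four_block_mat (mat 1 1 (\<lambda>_. e)) (0\<^sub>m 1 n) (0\<^sub>m n 1) (V * mat_diag n (\<lambda>k. complex_of_real (l k)))"
      unfolding V'_def D4 using V
      by (subst mult_four_block_mat[of _ 1 1 _ n _ n _ _ 1 _ n])
        (auto simp: left_mult_zero_mat[of _ n n])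
    show ?thesis unfolding * V'a B4 V(3) using V
      by (subst mult_four_block_mat[of _ 1 1 _ n _ n _ _ 1 _ n])
        (auto simp: left_mult_zero_mat[of _ n n] right_mult_zero_mat[of _ n n])
  qed
  have U: "W * V' \<in> carrier_mat (Suc n) (Suc n)" using W V' by auto
  let ?D = "mat_diag (Suc n) (\<lambda>k. complex_of_real (l' k))"
  have "mat_adjoint W * (W * V') = V'"
    using W V' by (simp flip: assoc_mult_mat[of _ "Suc n" "Suc n" _ "Suc n" _ "Suc n"])
  then have "mat_adjoint (W * V') * (W * V') = 1\<^sub>m (Suc n)"
    using W V' V'V' by (simp add: mat_adjoint_mult assoc_mult_mat[of _ "Suc n" "Suc n" _ "Suc n" _ "Suc n"])
  moreover have "A = W * V' * ?D * mat_adjoint (W * V')"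
    unfolding AB BV using W V'
    by (simp add: mat_adjoint_mult assoc_mult_mat[of _ "Suc n" "Suc n" _ "Suc n" _ "Suc n"])
  ultimately show ?case using Suc.prems(1) U by blast
qed

section \<open>Quadratic forms in spectral coordinates and singular values\<close>

lemma mult_mat_vec_square [simp]:
  "A \<in> carrier_mat n n \<Longrightarrow> x \<in> carrier_vec n \<Longrightarrow> A *\<^sub>v x \<in> carrier_vec n"
  by simp

text \<open>In the coordinates \<open>y\<close> the matrix acts diagonally, and unitary maps
  preserve norms. Hence the three quantities are the moments of order 1, 2 and 0 of the
  \<open>l k\<close> with common weights \<open>(cmod (y $ k))\<^sup>2\<close>.\<close>

lemma unitary_spectral_forms:
  fixes l :: "nat \<Rightarrow> real"
  assumes U: "U \<in> carrier_mat n n" "mat_adjoint U * U = 1\<^sub>m n"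
    and A: "A = U * mat_diag n (\<lambda>k. complex_of_real (l k)) * mat_adjoint U"
    and x: "x \<in> carrier_vec n"
  defines "y \<equiv> mat_adjoint U *\<^sub>v x"
  shows "quad_form A x = complex_of_real (\<Sum>k<n. l k * (cmod (y $ k))\<^sup>2)"
    and "(eucl_norm (A *\<^sub>v x))\<^sup>2 = (\<Sum>k<n. (l k)\<^sup>2 * (cmod (y $ k))\<^sup>2)"
    and "(eucl_norm x)\<^sup>2 = (\<Sum>k<n. (cmod (y $ k))\<^sup>2)"
proof -
  let ?D = "mat_diag n (\<lambda>k. complex_of_real (l k))"
  have y: "y \<in> carrier_vec n" using U x by (auto simp: y_def)
  have U': "mat_adjoint U \<in> carrier_mat n n" "mat_adjoint (mat_adjoint U) * mat_adjoint U = 1\<^sub>m n"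
    using U unitary_mult_adjoint[OF U] by auto
  have Dy: "(?D *\<^sub>v y) $ k = complex_of_real (l k) * y $ k" if "k < n" for k
  proof -
    have "(?D *\<^sub>v y) $ k = (\<Sum>j = 0..<n. (if k = j then complex_of_real (l j) else 0) * y $ j)"
      using that y by (simp add: mat_diag_def scalar_prod_def)
    also have "\<dots> = (\<Sum>j = 0..<n. if k = j then complex_of_real (l j) * y $ j else 0)"
      by (rule sum.cong) auto
    finally show ?thesis using that by simp
  qed
  have Dyc: "?D *\<^sub>v y \<in> carrier_vec n" using y by (intro mult_mat_vec_carrier[of _ n n]) auto
  have dimDy: "dim_vec (?D *\<^sub>v y) = n" using Dyc by (rule carrier_vecD)
  have Ax: "A *\<^sub>v x = U *\<^sub>v (?D *\<^sub>v y)"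
    using U x unfolding A y_def
    by (simp add: assoc_mult_mat_vec[of _ n n _ n])
  have "quad_form A x = (?D *\<^sub>v y) \<bullet>c y"
    unfolding quad_form_def Ax y_def[symmetric] using U x Dyc
    by (subst cscalar_prod_adjoint[of U n n]) (auto simp: y_def)
  also have "\<dots> = (\<Sum>k<n. complex_of_real (l k) * (y $ k * cnj (y $ k)))"
    using y Dy by (simp add: scalar_prod_def lessThan_atLeast0 mult_ac)
  finally show "quad_form A x = complex_of_real (\<Sum>k<n. l k * (cmod (y $ k))\<^sup>2)"
    by (simp add: complex_norm_square del: of_real_power)
  have "(eucl_norm (A *\<^sub>v x))\<^sup>2 = (eucl_norm (?D *\<^sub>v y))\<^sup>2"
    unfolding Ax using unitary_eucl_norm[OF U Dyc] by simp
  then show "(eucl_norm (A *\<^sub>v x))\<^sup>2 = (\<Sum>k<n. (l k)\<^sup>2 * (cmod (y $ k))\<^sup>2)"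
    unfolding eucl_norm_square dimDy using Dy by (simp add: norm_mult power_mult_distrib)
  show "(eucl_norm x)\<^sup>2 = (\<Sum>k<n. (cmod (y $ k))\<^sup>2)"
    using unitary_eucl_norm[OF U' x] y unfolding y_def[symmetric] by (metis carrier_vecD eucl_norm_square)
qed

lemma unitary_spectral_eigenvector:
  fixes l :: "nat \<Rightarrow> real"
  assumes U: "U \<in> carrier_mat n n" "mat_adjoint U * U = 1\<^sub>m n"
    and A: "A = U * mat_diag n (\<lambda>k. complex_of_real (l k)) * mat_adjoint U"
    and k: "k < n"
  shows "eigenvector A (U *\<^sub>v unit_vec n k) (complex_of_real (l k))"
proof -
  let ?D = "mat_diag n (\<lambda>k. complex_of_real (l k))"
  let ?u = "U *\<^sub>v unit_vec n k"
  have Uu: "mat_adjoint U *\<^sub>v ?u = unit_vec n k"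
    using U by (simp flip: assoc_mult_mat_vec[of _ n n _ n])
  have De: "?D *\<^sub>v unit_vec n k = complex_of_real (l k) \<cdot>\<^sub>v unit_vec n k"
    using k by (intro eq_vecI) (auto simp: mat_diag_def)
  have "A *\<^sub>v ?u = U *\<^sub>v (?D *\<^sub>v (mat_adjoint U *\<^sub>v ?u))"
    using U unfolding A by (simp add: assoc_mult_mat_vec[of _ n n _ n])
  also have "\<dots> = complex_of_real (l k) \<cdot>\<^sub>v ?u"
    unfolding Uu De using U by (simp add: mult_mat_vec[of _ n n])
  finally have "A *\<^sub>v ?u = complex_of_real (l k) \<cdot>\<^sub>v ?u" .
  moreover have "?u \<noteq> 0\<^sub>v n"
  proof
    assume "?u = 0\<^sub>v n"
    then have "mat_adjoint U *\<^sub>v ?u = 0\<^sub>v n" using U by auto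
    then show False using Uu k by (auto dest: arg_cong[of _ _ "\<lambda>v. v $ k"])
  qed
  ultimately show ?thesis using U k unfolding eigenvector_def by (simp add: A)
qed

text \<open>The spectral theorem is applied to \<open>mat_adjoint A * A\<close>, whose form at
  \<open>x\<close> is the squared norm of \<open>A *\<^sub>v x\<close>; this norm is thus a weighted
  sum of squared singular values. Positive size makes the set of singular values nonempty, so that
  \<open>Min\<close> and \<open>Max\<close> are attained.\<close>

lemma singular_values_bounds:
  assumes A: "A \<in> carrier_mat n n" and n: "n > 0"
  shows "finite (singular_values A)" "singular_values A \<noteq> {}"
    and "0 \<le> sigma_min A" "0 \<le> sigma_max A"
    and "x \<in> carrier_vec n \<Longrightarrow> eucl_norm (A *\<^sub>v x) \<le> sigma_max A * eucl_norm x"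
    and "x \<in> carrier_vec n \<Longrightarrow> sigma_min A * eucl_norm x \<le> eucl_norm (A *\<^sub>v x)"
proof -
  let ?B = "mat_adjoint A * A"
  have B: "?B \<in> carrier_mat n n" using A by simp
  have "mat_adjoint ?B = ?B" using A by (simp add: mat_adjoint_mult)
  then obtain U and l :: "nat \<Rightarrow> real" where U: "U \<in> carrier_mat n n" "mat_adjoint U * U = 1\<^sub>m n"
    and BU: "?B = U * mat_diag n (\<lambda>k. complex_of_real (l k)) * mat_adjoint U"
    using hermitian_spectral[OF B] by metis
  have quadB: "quad_form ?B x = complex_of_real ((eucl_norm (A *\<^sub>v x))\<^sup>2)"
    if x: "x \<in> carrier_vec n" for x
  proof -
    have "quad_form ?B x = (mat_adjoint A *\<^sub>v (A *\<^sub>v x)) \<bullet>c x"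
      using A x by (simp add: quad_form_def assoc_mult_mat_vec[of _ n n _ n])
    also have "\<dots> = (A *\<^sub>v x) \<bullet>c (A *\<^sub>v x)"
      using A x by (subst cscalar_prod_adjoint[of _ n n]) auto
    finally show ?thesis by (simp only: cscalar_prod_self)
  qed
  \<comment> \<open>At a unit eigenvector \<open>?u\<close> the form of \<open>?B\<close> is both
    \<open>l k\<close> and the squared norm of \<open>A *\<^sub>v ?u\<close>. Hence
    \<open>l k\<close> is nonnegative and its root is a singular value.\<close>
  have sv: "sqrt (l k) \<in> singular_values A" "l k \<ge> 0" if k: "k < n" for k
  proof -
    let ?u = "U *\<^sub>v unit_vec n k"
    have ev: "eigenvector ?B ?u (complex_of_real (l k))"
      by (rule unitary_spectral_eigenvector[OF U BU k])
    have u: "?u \<in> carrier_vec n" using U by simp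
    have "quad_form ?B ?u = complex_of_real (l k) * (?u \<bullet>c ?u)"
      using ev u by (simp add: quad_form_def eigenvector_def)
    then have "complex_of_real ((eucl_norm (A *\<^sub>v ?u))\<^sup>2) = complex_of_real (l k * (eucl_norm ?u)\<^sup>2)"
      using quadB[OF u] by (simp add: cscalar_prod_self)
    then have *: "(eucl_norm (A *\<^sub>v ?u))\<^sup>2 = l k * (eucl_norm ?u)\<^sup>2"
      by (simp only: of_real_eq_iff)
    have "eucl_norm ?u = 1" using unitary_eucl_norm[OF U, of "unit_vec n k"] k
      by (simp add: eucl_norm_def unit_vec_def if_distrib[of cmod] if_distrib[of "\<lambda>x. x\<^sup>2"] cong: if_cong)
    then show "l k \<ge> 0" using * by (metis mult.right_neutral power_one zero_le_power2)
    then show "sqrt (l k) \<in> singular_values A"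
      using ev by (auto simp: singular_values_def eigenvalue_def simp del: of_real_power)
  qed
  \<comment> \<open>Finiteness: squaring is injective on nonnegative reals and maps the singular
    values into the finite spectrum of \<open>?B\<close>.\<close>
  have "(\<lambda>s. complex_of_real (s\<^sup>2)) ` singular_values A \<subseteq> spectrum ?B"
    by (auto simp: singular_values_def spectrum_def)
  then have "finite ((\<lambda>s. complex_of_real (s\<^sup>2)) ` singular_values A)"
    by (rule finite_subset) (rule card_finite_spectrum(1)[OF B])
  moreover have "inj_on (\<lambda>s. complex_of_real (s\<^sup>2)) (singular_values A)"
    by (intro inj_onI, simp only: of_real_eq_iff) (auto simp: singular_values_def power2_eq_iff_nonneg)
  ultimately show fin: "finite (singular_values A)" by (rule finite_imageD)
  show ne: "singular_values A \<noteq> {}" using sv(1)[OF n] by blast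
  have nonneg: "s \<ge> 0" if "s \<in> singular_values A" for s
    using that by (simp add: singular_values_def)
  show s0: "0 \<le> sigma_min A" "0 \<le> sigma_max A"
    unfolding sigma_min_def sigma_max_def
    using nonneg[OF Min_in[OF fin ne]] nonneg[OF Max_in[OF fin ne]] by blast+
  have lk: "(sigma_min A)\<^sup>2 \<le> l k" "l k \<le> (sigma_max A)\<^sup>2" if "k < n" for k
  proof -
    have "sigma_min A \<le> sqrt (l k)" "sqrt (l k) \<le> sigma_max A"
      using sv(1)[OF that] fin by (auto simp: sigma_min_def sigma_max_def)
    then show "(sigma_min A)\<^sup>2 \<le> l k" "l k \<le> (sigma_max A)\<^sup>2"
      using s0 sv(2)[OF that] power_mono[of "sigma_min A" "sqrt (l k)" 2] power_mono[of "sqrt (l k)" "sigma_max A" 2]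
      by auto
  qed
  have eq: "(eucl_norm (A *\<^sub>v x))\<^sup>2 = (\<Sum>k<n. l k * (cmod ((mat_adjoint U *\<^sub>v x) $ k))\<^sup>2)"
    if "x \<in> carrier_vec n" for x
    using unitary_spectral_forms(1)[OF U BU that] quadB[OF that] by (simp only: of_real_eq_iff)
  show "eucl_norm (A *\<^sub>v x) \<le> sigma_max A * eucl_norm x" if x: "x \<in> carrier_vec n"
  proof (rule power2_le_imp_le)
    show "(eucl_norm (A *\<^sub>v x))\<^sup>2 \<le> (sigma_max A * eucl_norm x)\<^sup>2"
      unfolding eq[OF x] power_mult_distrib unitary_spectral_forms(3)[OF U BU x] sum_distrib_left
      using lk by (intro sum_mono mult_right_mono) auto
  qed (use s0 in auto)
  show "sigma_min A * eucl_norm x \<le> eucl_norm (A *\<^sub>v x)" if x: "x \<in> carrier_vec n"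
  proof (rule power2_le_imp_le)
    show "(sigma_min A * eucl_norm x)\<^sup>2 \<le> (eucl_norm (A *\<^sub>v x))\<^sup>2"
      unfolding eq[OF x] power_mult_distrib unitary_spectral_forms(3)[OF U BU x] sum_distrib_left
      using lk by (intro sum_mono mult_right_mono) auto
  qed auto
qed

section \<open>Separating quadratic forms\<close>

text \<open>One shape for all three conditions; a complex \<open>b\<close> allows the rotation in
  the phase condition. The value depends on \<open>A\<close> only through
  \<open>A *\<^sub>v x\<close>.\<close>

definition quad_multiplier :: "real \<Rightarrow> complex \<Rightarrow> real \<Rightarrow> complex mat \<Rightarrow> complex vec \<Rightarrow> real" where
  "quad_multiplier a b c A x =
     a * (eucl_norm (A *\<^sub>v x))\<^sup>2 + Re (b * quad_form A x) + c * (eucl_norm x)\<^sup>2"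

lemma eucl_norm_append: "(eucl_norm (u @\<^sub>v v))\<^sup>2 = (eucl_norm u)\<^sup>2 + (eucl_norm v)\<^sup>2"
proof -
  have split: "(\<Sum>i<a + b. f i) = (\<Sum>i<a. f i) + (\<Sum>i<b. f (a + i))" for a b and f :: "nat \<Rightarrow> real"
    by (induction b) (simp_all add: add_ac)
  show ?thesis unfolding eucl_norm_square by (simp add: split)
qed

lemma quad_multiplier_block:
  assumes A: "A \<in> carrier_mat n n" and D: "D \<in> carrier_mat m m"
    and u: "u \<in> carrier_vec n" and v: "v \<in> carrier_vec m"
  shows "quad_multiplier a b c (four_block_mat A (0\<^sub>m n m) (0\<^sub>m m n) D) (u @\<^sub>v v) =
    quad_multiplier a b c A u + quad_multiplier a b c D v"
proof -
  let ?F = "four_block_mat A (0\<^sub>m n m) (0\<^sub>m m n) D"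
  have F: "?F *\<^sub>v (u @\<^sub>v v) = (A *\<^sub>v u) @\<^sub>v (D *\<^sub>v v)"
    using assms by (subst four_block_mat_mult_vec[of _ n n _ m _ m]) auto
  have conj: "conjugate (u @\<^sub>v v) = conjugate u @\<^sub>v conjugate v" by auto
  have "quad_form ?F (u @\<^sub>v v) = quad_form A u + quad_form D v"
    unfolding quad_form_def F conj using assms by (subst scalar_prod_append[of _ n _ m]) auto
  then show ?thesis
    by (simp add: quad_multiplier_def F eucl_norm_append algebra_simps)
qed

lemma diag_block_mat_square:
  assumes "\<forall>A \<in> set As. square_mat A"
  shows "diag_block_mat As \<in> carrier_mat (sum_list (map dim_row As)) (sum_list (map dim_row As))"
proof -
  have "map dim_col As = map dim_row As" using assms by auto
  then show ?thesis by (intro carrier_matI) (simp_all only: dim_diag_block_mat)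
qed

text \<open>By additivity the value at \<open>x\<close> is a sum over the components of
  \<open>x\<close>, to which zero components contribute nothing; a nonpositive sum over the nonzero
  components has a nonpositive term. The existential form lets the induction pass on the offending
  block.\<close>

lemma quad_multiplier_diag_block_mat:
  assumes "\<forall>A \<in> set As. square_mat A"
    and "x \<in> carrier_vec (sum_list (map dim_row As))" "x \<noteq> 0\<^sub>v (sum_list (map dim_row As))"
    and "quad_multiplier a b c (diag_block_mat As) x \<le> 0"
  shows "\<exists>A \<in> set As. \<exists>y \<in> carrier_vec (dim_row A). y \<noteq> 0\<^sub>v (dim_row A) \<and> quad_multiplier a b c A y \<le> 0"
  using assms
proof (induction As arbitrary: x)
  case Nil
  then show ?case by auto
next
  case (Cons A As)
  let ?n = "dim_row A" and ?m = "sum_list (map dim_row As)"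
  have A: "A \<in> carrier_mat ?n ?n" using Cons.prems(1) by (auto intro!: carrier_matI)
  have D: "diag_block_mat As \<in> carrier_mat ?m ?m" using Cons.prems(1) by (intro diag_block_mat_square) auto
  define u v where "u = vec_first x ?n" and "v = vec_last x ?m"
  have uv: "u \<in> carrier_vec ?n" "v \<in> carrier_vec ?m" by (auto simp: u_def v_def)
  have x: "x = u @\<^sub>v v" unfolding u_def v_def
    by (rule vec_first_last_append[symmetric]) (use Cons.prems(2) in simp)
  have F: "diag_block_mat (A # As) = four_block_mat A (0\<^sub>m ?n ?m) (0\<^sub>m ?m ?n) (diag_block_mat As)"
    by (simp only: diag_block_mat.simps Let_def carrier_matD[OF D] carrier_matD(2)[OF A])
  have sum: "quad_multiplier a b c A u + quad_multiplier a b c (diag_block_mat As) v \<le> 0"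
    using Cons.prems(4) unfolding F x quad_multiplier_block[OF A D uv] .
  have zero: "quad_multiplier a b c M (0\<^sub>v k) = 0" if "M \<in> carrier_mat k k" for M k
    using that by (simp add: quad_multiplier_def quad_form_def eucl_norm_def)
  have "0\<^sub>v ?n @\<^sub>v 0\<^sub>v ?m = (0\<^sub>v (?n + ?m) :: complex vec)" by auto
  then have "u \<noteq> 0\<^sub>v ?n \<or> v \<noteq> 0\<^sub>v ?m" using Cons.prems(3) x by auto
  then consider "u \<noteq> 0\<^sub>v ?n" "quad_multiplier a b c A u \<le> 0"
    | "v \<noteq> 0\<^sub>v ?m" "quad_multiplier a b c (diag_block_mat As) v \<le> 0"
    using sum zero[OF A] zero[OF D] by fastforce
  then show ?case
  proof cases
    case 1
    then show ?thesis using uv by auto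
  next
    case 2
    then show ?thesis using Cons.IH[OF _ uv(2)] Cons.prems(1) by auto
  qed
qed

section \<open>Complex forms and inverses of positive definite matrices\<close>

lemma mat_inv_inverts:
  assumes A: "A \<in> carrier_mat n n" and d: "det A \<noteq> 0"
  shows "mat_inv A \<in> carrier_mat n n" "A * mat_inv A = 1\<^sub>m n" "mat_inv A * A = 1\<^sub>m n"
proof -
  have "mat_inverse A \<noteq> None"
    using mat_inverse(1)[OF A, of "()"] det_non_zero_imp_unit[OF A d, of "()"] by blast
  then have "mat_inverse A = Some (mat_inv A)" by (auto simp: mat_inv_def)
  from mat_inverse(2)[OF A this]
  show "mat_inv A \<in> carrier_mat n n" "A * mat_inv A = 1\<^sub>m n" "mat_inv A * A = 1\<^sub>m n" by auto
qed

lemma quad_form_sum: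
  "A \<in> carrier_mat n n \<Longrightarrow> x \<in> carrier_vec n \<Longrightarrow>
    quad_form A x = (\<Sum>i<n. \<Sum>j<n. A $$ (i, j) * x $ j * cnj (x $ i))"
  by (simp add: quad_form_def scalar_prod_def sum_distrib_right lessThan_atLeast0)

text \<open>For \<open>x\<close> with real part \<open>a\<close> and imaginary part
  \<open>b\<close>, the real part of the complex form is the sum of the real forms at
  \<open>a\<close> and \<open>b\<close>, and one of these vectors is nonzero if \<open>x\<close>
  is.\<close>

lemma positive_definite_complex:
  fixes H :: "real mat"
  assumes H: "H \<in> carrier_mat n n" "positive_definite H"
  defines "C \<equiv> map_mat complex_of_real H"
  shows "mat_adjoint C = C"
    and "x \<in> carrier_vec n \<Longrightarrow> x \<noteq> 0\<^sub>v n \<Longrightarrow> Re (quad_form C x) > 0"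
proof -
  have sym: "H $$ (i, j) = H $$ (j, i)" if "i < n" "j < n" for i j
    using H that unfolding positive_definite_def by (metis carrier_matD index_transpose_mat(1))
  have pos: "(\<Sum>i<n. \<Sum>j<n. a $ i * (H $$ (i, j) * a $ j)) \<ge> 0"
    "a \<noteq> 0\<^sub>v n \<Longrightarrow> (\<Sum>i<n. \<Sum>j<n. a $ i * (H $$ (i, j) * a $ j)) > 0"
    if a: "a \<in> carrier_vec n" for a
  proof -
    have eq: "(\<Sum>i<n. \<Sum>j<n. a $ i * (H $$ (i, j) * a $ j)) = a \<bullet> (H *\<^sub>v a)"
      using H a by (simp add: scalar_prod_def sum_distrib_left lessThan_atLeast0)
    show *: "a \<noteq> 0\<^sub>v n \<Longrightarrow> (\<Sum>i<n. \<Sum>j<n. a $ i * (H $$ (i, j) * a $ j)) > 0"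
      using H a unfolding eq positive_definite_def by auto
    show "(\<Sum>i<n. \<Sum>j<n. a $ i * (H $$ (i, j) * a $ j)) \<ge> 0"
      using * by (cases "a = 0\<^sub>v n") auto
  qed
  show "mat_adjoint C = C"
    using H sym by (intro eq_matI) (auto simp: C_def)
  assume x: "x \<in> carrier_vec n" "x \<noteq> 0\<^sub>v n"
  define a b where "a = map_vec Re x" and "b = map_vec Im x"
  have ab: "a \<in> carrier_vec n" "b \<in> carrier_vec n" using x by (auto simp: a_def b_def)
  have "Re (quad_form C x) = (\<Sum>i<n. \<Sum>j<n. a $ i * (H $$ (i, j) * a $ j) + b $ i * (H $$ (i, j) * b $ j))"
    using H x by (subst quad_form_sum[of _ n])
      (auto simp: C_def a_def b_def algebra_simps intro!: sum.cong)
  also have "\<dots> = (\<Sum>i<n. \<Sum>j<n. a $ i * (H $$ (i, j) * a $ j)) + (\<Sum>i<n. \<Sum>j<n. b $ i * (H $$ (i, j) * b $ j))"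
    by (simp add: sum.distrib)
  also have "\<dots> > 0"
  proof -
    have "a \<noteq> 0\<^sub>v n \<or> b \<noteq> 0\<^sub>v n"
    proof (rule ccontr)
      assume "\<not> ?thesis"
      then have "Re (x $ i) = 0 \<and> Im (x $ i) = 0" if "i < n" for i
        using that x by (metis a_def b_def carrier_vecD index_map_vec(1) index_zero_vec(1))
      then have "x = 0\<^sub>v n" using x by (intro eq_vecI) (auto simp: complex_eq_iff)
      then show False using x by simp
    qed
    then show ?thesis
      using pos[OF ab(1)] pos[OF ab(2)] by (auto intro: add_pos_nonneg add_nonneg_pos)
  qed
  finally show "Re (quad_form C x) > 0" .
qed

text \<open>Let \<open>y\<close> be the image of \<open>x\<close> under \<open>mat_inv C\<close>, so
  that \<open>C\<close> maps \<open>y\<close> to \<open>x\<close>; then the form of the inverse at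
  \<open>x\<close> is the form of \<open>C\<close> at \<open>y\<close>. Taking adjoints in
  \<open>C * mat_inv C = 1\<^sub>m n\<close> shows the adjoint of the inverse to be a left inverse
  of \<open>C\<close>, hence the inverse itself.\<close>

lemma positive_definite_mat_inv:
  fixes H :: "real mat"
  assumes H: "H \<in> carrier_mat n n" "positive_definite H"
  defines "C \<equiv> map_mat complex_of_real H"
  shows "mat_inv C \<in> carrier_mat n n" "mat_inv C * C = 1\<^sub>m n"
    and "mat_adjoint (mat_inv C) = mat_inv C"
    and "x \<in> carrier_vec n \<Longrightarrow> x \<noteq> 0\<^sub>v n \<Longrightarrow> Re (quad_form (mat_inv C) x) > 0"
proof -
  note C = positive_definite_complex[OF H, folded C_def]
  have Cc: "C \<in> carrier_mat n n" using H by (simp add: C_def)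
  have "det C \<noteq> 0"
  proof
    assume "det C = 0"
    then obtain v where "v \<in> carrier_vec n" "v \<noteq> 0\<^sub>v n" "C *\<^sub>v v = 0\<^sub>v n"
      using det_0_iff_vec_prod_zero[OF Cc] by auto
    with C(2)[of v] show False by (simp add: quad_form_def)
  qed
  note I = mat_inv_inverts[OF Cc this]
  show K: "mat_inv C \<in> carrier_mat n n" "mat_inv C * C = 1\<^sub>m n" by fact+
  let ?K = "mat_inv C"
  have "mat_adjoint ?K * C = 1\<^sub>m n"
    using arg_cong[OF I(2), of mat_adjoint] Cc K C(1) by (simp add: mat_adjoint_mult)
  then have "mat_adjoint ?K = mat_adjoint ?K * (C * ?K)" "mat_adjoint ?K * C * ?K = ?K"
    using I K by auto
  then show adj: "mat_adjoint ?K = ?K"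
    using K Cc by (simp add: assoc_mult_mat[of _ n n _ n _ n])
  assume x: "x \<in> carrier_vec n" "x \<noteq> 0\<^sub>v n"
  define y where "y = ?K *\<^sub>v x"
  have y: "y \<in> carrier_vec n" using K x by (simp add: y_def)
  have Cy: "C *\<^sub>v y = x"
    using K Cc x I(2) unfolding y_def by (simp flip: assoc_mult_mat_vec[of _ n n _ n])
  then have "y \<noteq> 0\<^sub>v n" using x Cc by auto
  have "quad_form ?K x = y \<bullet>c (C *\<^sub>v y)" by (simp add: quad_form_def y_def[symmetric] Cy)
  also have "\<dots> = quad_form C y"
    unfolding quad_form_def using cscalar_prod_adjoint[OF Cc y y] C(1) by simp
  finally show "Re (quad_form ?K x) > 0" using C(2)[OF y \<open>y \<noteq> 0\<^sub>v n\<close>] by simp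
qed

section \<open>Scaling of the forms and the determinant criterion\<close>

lemma smult_mat_mult_mat_vec_assoc:
  "A \<in> carrier_mat n m \<Longrightarrow> x \<in> carrier_vec m \<Longrightarrow> (c \<cdot>\<^sub>m A) *\<^sub>v x = c \<cdot>\<^sub>v (A *\<^sub>v x)"
  by (rule eq_vecI) (auto simp: scalar_prod_def sum_distrib_left mult_ac)

lemma quad_form_smult:
  "A \<in> carrier_mat n n \<Longrightarrow> x \<in> carrier_vec n \<Longrightarrow>
    quad_form A (c \<cdot>\<^sub>v x) = complex_of_real ((cmod c)\<^sup>2) * quad_form A x"
  by (simp add: quad_form_def mult_mat_vec[of _ n n] conjugate_smult_vec complex_norm_square mult_ac
      del: of_real_power)

lemma quad_multiplier_smult:
  "A \<in> carrier_mat n n \<Longrightarrow> x \<in> carrier_vec n \<Longrightarrow>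
    quad_multiplier a b c A (d \<cdot>\<^sub>v x) = (cmod d)\<^sup>2 * quad_multiplier a b c A x"
  by (simp add: quad_multiplier_def quad_form_smult[of _ n] mult_mat_vec[of _ n n] eucl_norm_smult
      power_mult_distrib algebra_simps)

lemma unit_vecs_of_normalize:
  "x \<in> carrier_vec n \<Longrightarrow> x \<noteq> 0\<^sub>v n \<Longrightarrow> complex_of_real (1 / eucl_norm x) \<cdot>\<^sub>v x \<in> unit_vecs_of n"
  using eucl_norm_pos_iff[of x n]
  by (auto simp: unit_vecs_of_def eucl_norm_smult simp del: of_real_divide)

text \<open>Cauchy-Schwarz, read off from the nonnegative squared norm of \<open>A x - q x\<close>,
  where \<open>q\<close> is the real part of the form. It puts \<open>xz_graph A\<close> on or above
  the parabola \<open>z = x\<^sup>2\<close>.\<close>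

lemma quad_form_le_eucl_norm:
  assumes "A \<in> carrier_mat n n" "x \<in> unit_vecs_of n"
  shows "(Re (quad_form A x))\<^sup>2 \<le> (eucl_norm (A *\<^sub>v x))\<^sup>2"
proof -
  have x: "dim_vec x = n" "(\<Sum>i<n. (cmod (x $ i))\<^sup>2) = 1"
    using assms eucl_norm_square[of x] by (auto simp: unit_vecs_of_def)
  define z where "z = A *\<^sub>v x"
  have z: "dim_vec z = n" using assms by (simp add: z_def)
  define q where "q = Re (quad_form A x)"
  have q: "q = (\<Sum>i<n. Re (z $ i * cnj (x $ i)))"
    using assms x z by (simp add: q_def quad_form_def scalar_prod_def lessThan_atLeast0 flip: z_def)
  have "0 \<le> (\<Sum>i<n. (cmod (z $ i - complex_of_real q * x $ i))\<^sup>2)" by (intro sum_nonneg) auto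
  also have "\<dots> = (\<Sum>i<n. (cmod (z $ i))\<^sup>2 - 2 * q * Re (z $ i * cnj (x $ i)) + q\<^sup>2 * (cmod (x $ i))\<^sup>2)"
    by (intro sum.cong refl) (simp add: cmod_power2, simp add: power2_eq_square algebra_simps)
  also have "\<dots> = (\<Sum>i<n. (cmod (z $ i))\<^sup>2) - 2 * q * (\<Sum>i<n. Re (z $ i * cnj (x $ i))) + q\<^sup>2 * (\<Sum>i<n. (cmod (x $ i))\<^sup>2)"
    by (simp only: sum.distrib sum_subtractf sum_distrib_left)
  also have "\<dots> = (eucl_norm z)\<^sup>2 - q\<^sup>2"
    unfolding q[symmetric] x(2) eucl_norm_square z by (simp add: power2_eq_square)
  finally show ?thesis by (simp add: q_def z_def)
qed

text \<open>A vector \<open>x\<close> annihilated by \<open>I + \<tau> Hc A\<close> has the same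
  image under \<open>A\<close> as under \<open>- (1 / \<tau>) K\<close>, hence the same value of the
  form; but one value is positive and the other nonpositive. For \<tau> = 0, where 1 / \<tau> is
  meaningless, the matrix is the identity; hence the guard on \<open>mult\<close>.\<close>

lemma quad_multiplier_det_nonzero:
  fixes Hc K A :: "complex mat"
  assumes As: "\<forall>A \<in> set As. square_mat A" "m = sum_list (map dim_row As)"
    and Hc: "Hc \<in> carrier_mat m m" and K: "K \<in> carrier_mat m m" "K * Hc = 1\<^sub>m m"
    and \<tau>: "0 \<le> \<tau>"
    and mult: "0 < \<tau> \<Longrightarrow> \<exists>a b c.
      (\<forall>A \<in> set As. \<forall>y \<in> carrier_vec (dim_row A). y \<noteq> 0\<^sub>v (dim_row A) \<longrightarrow> 0 < quad_multiplier a b c A y) \<and>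
      (\<forall>x \<in> carrier_vec m. quad_multiplier a b c (complex_of_real (- (1 / \<tau>)) \<cdot>\<^sub>m K) x \<le> 0)"
  shows "det (1\<^sub>m m + complex_of_real \<tau> \<cdot>\<^sub>m (Hc * diag_block_mat As)) \<noteq> 0"
proof
  let ?A = "diag_block_mat As"
  let ?t = "complex_of_real (- (1 / \<tau>))"
  have A: "?A \<in> carrier_mat m m" unfolding As(2) by (rule diag_block_mat_square[OF As(1)])
  assume "det (1\<^sub>m m + complex_of_real \<tau> \<cdot>\<^sub>m (Hc * ?A)) = 0"
  then obtain x where x: "x \<in> carrier_vec m" "x \<noteq> 0\<^sub>v m"
    and eq: "(1\<^sub>m m + complex_of_real \<tau> \<cdot>\<^sub>m (Hc * ?A)) *\<^sub>v x = 0\<^sub>v m"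
    using det_0_iff_vec_prod_zero[of "1\<^sub>m m + complex_of_real \<tau> \<cdot>\<^sub>m (Hc * ?A)" m] A Hc by auto
  define w where "w = ?A *\<^sub>v x"
  have w: "w \<in> carrier_vec m" using A x by (simp add: w_def)
  have eq2: "x + complex_of_real \<tau> \<cdot>\<^sub>v (Hc *\<^sub>v w) = 0\<^sub>v m"
    using eq A Hc x unfolding w_def
    by (simp add: add_mult_distrib_mat_vec[of _ m m] smult_mat_mult_mat_vec_assoc[of _ m m]
        assoc_mult_mat_vec[of _ m m _ m])
  \<comment> \<open>Multiplication by \<open>K\<close>, a left inverse of \<open>Hc\<close>,
    isolates \<open>w\<close>.\<close>
  have eq3: "K *\<^sub>v x + complex_of_real \<tau> \<cdot>\<^sub>v w = 0\<^sub>v m"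
  proof -
    have "K *\<^sub>v (x + complex_of_real \<tau> \<cdot>\<^sub>v (Hc *\<^sub>v w)) = K *\<^sub>v x + complex_of_real \<tau> \<cdot>\<^sub>v ((K * Hc) *\<^sub>v w)"
      using K(1) Hc x w by (simp add: mult_add_distrib_mat_vec[of _ m m] mult_mat_vec[of _ m m]
          assoc_mult_mat_vec[of _ m m _ m])
    moreover have "K *\<^sub>v 0\<^sub>v m = 0\<^sub>v m" using K(1) by (intro eq_vecI) auto
    ultimately show ?thesis unfolding eq2 K(2) using w by simp
  qed
  have "\<tau> \<noteq> 0"
  proof
    assume "\<tau> = 0"
    then have "x $ i = 0" if "i < m" for i
      using arg_cong[OF eq2, of "\<lambda>v. v $ i"] that x w Hc by simp
    then have "x = 0\<^sub>v m" using x by (intro eq_vecI) auto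
    then show False using x by simp
  qed
  then have \<tau>: "\<tau> > 0" using \<tau> by simp
  have wK: "w = (?t \<cdot>\<^sub>m K) *\<^sub>v x"
  proof (rule eq_vecI)
    fix i assume "i < dim_vec ((?t \<cdot>\<^sub>m K) *\<^sub>v x)"
    then have i: "i < m" using K by simp
    have "(K *\<^sub>v x) $ i + complex_of_real \<tau> * w $ i = 0"
      using arg_cong[OF eq3, of "\<lambda>v. v $ i"] i w K x by simp
    then have "w $ i = ?t * (K *\<^sub>v x) $ i"
      using \<tau> by (simp add: field_simps add_eq_0_iff)
    then show "w $ i = ((?t \<cdot>\<^sub>m K) *\<^sub>v x) $ i"
      using i K x by (simp add: smult_mat_mult_mat_vec_assoc[of _ m m])
  qed (use w K in simp)
  obtain a b c where abc:
    "\<forall>A \<in> set As. \<forall>y \<in> carrier_vec (dim_row A). y \<noteq> 0\<^sub>v (dim_row A) \<longrightarrow> 0 < quad_multiplier a b c A y"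
    "\<forall>x \<in> carrier_vec m. quad_multiplier a b c (?t \<cdot>\<^sub>m K) x \<le> 0"
    using mult[OF \<tau>] by blast
  \<comment> \<open>The form sees a matrix only through the image of \<open>x\<close>, and both
    images are \<open>w\<close>.\<close>
  have "quad_multiplier a b c ?A x = quad_multiplier a b c (?t \<cdot>\<^sub>m K) x"
    unfolding quad_multiplier_def quad_form_def w_def[symmetric] wK[symmetric] ..
  also have "\<dots> \<le> 0" using abc(2) x by blast
  finally have "\<exists>A \<in> set As. \<exists>y \<in> carrier_vec (dim_row A). y \<noteq> 0\<^sub>v (dim_row A) \<and> quad_multiplier a b c A y \<le> 0"
    using quad_multiplier_diag_block_mat[OF As(1), folded As(2)] x by blast
  then show False using abc(1) by force
qed

section \<open>The gain and phase conditions\<close>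

lemma quad_multiplier_smult_mat:
  assumes "K \<in> carrier_mat m m" "x \<in> carrier_vec m"
  shows "quad_multiplier a b c (complex_of_real t \<cdot>\<^sub>m K) x =
    a * t\<^sup>2 * (eucl_norm (K *\<^sub>v x))\<^sup>2 + t * Re (b * quad_form K x) + c * (eucl_norm x)\<^sup>2"
  using assms by (simp add: quad_multiplier_def quad_form_def smult_mat_mult_mat_vec_assoc[of _ m m]
      eucl_norm_smult power_mult_distrib algebra_simps)

text \<open>Every block has gain below the least singular value of \<open>mat_inv Hc\<close>, while
  \<open>mat_inv Hc\<close> stretches norms at least by that value, and the factor 1 / \<tau> \<ge>
  1 only stretches further.\<close>

lemma gain_multiplier:
  assumes As: "\<forall>A \<in> set As. square_mat A \<and> dim_row A > 0"
    and K: "mat_inv Hc \<in> carrier_mat m m" "m > 0" and \<tau>: "0 < \<tau>" "\<tau> \<le> 1"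
    and gain: "gain_condition As Hc"
  shows "\<exists>a b c.
      (\<forall>A \<in> set As. \<forall>y \<in> carrier_vec (dim_row A). y \<noteq> 0\<^sub>v (dim_row A) \<longrightarrow> 0 < quad_multiplier a b c A y) \<and>
      (\<forall>x \<in> carrier_vec m. quad_multiplier a b c (complex_of_real (- (1 / \<tau>)) \<cdot>\<^sub>m mat_inv Hc) x \<le> 0)"
proof (intro exI conjI ballI impI)
  let ?s = "sigma_min (mat_inv Hc)"
  fix A and y :: "complex vec" assume A: "A \<in> set As" and y: "y \<in> carrier_vec (dim_row A)" "y \<noteq> 0\<^sub>v (dim_row A)"
  have Ac: "A \<in> carrier_mat (dim_row A) (dim_row A)" "dim_row A > 0" using As A by (auto intro!: carrier_matI)
  note sv = singular_values_bounds[OF Ac]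
  have "sigma_max A < ?s"
    using gain A unfolding gain_condition_def by (meson List.finite_set Max_ge finite_imageI image_eqI le_less_trans)
  moreover have "eucl_norm y > 0" using y eucl_norm_pos_iff by blast
  ultimately have "eucl_norm (A *\<^sub>v y) < ?s * eucl_norm y"
    using sv(5)[OF y(1)] by (smt (verit) mult_strict_right_mono)
  then have "(eucl_norm (A *\<^sub>v y))\<^sup>2 < (?s * eucl_norm y)\<^sup>2"
    by (intro power_strict_mono) auto
  then show "0 < quad_multiplier (-1) 0 (?s\<^sup>2) A y"
    by (simp add: quad_multiplier_def power_mult_distrib)
next
  let ?s = "sigma_min (mat_inv Hc)"
  fix x :: "complex vec" assume x: "x \<in> carrier_vec m"
  note sv = singular_values_bounds[OF K]
  have "?s * eucl_norm x \<le> eucl_norm (mat_inv Hc *\<^sub>v x)" using sv(6)[OF x] .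
  then have "(?s * eucl_norm x)\<^sup>2 \<le> 1 * (eucl_norm (mat_inv Hc *\<^sub>v x))\<^sup>2"
    using sv(3) by (simp add: power_mono)
  also have "\<dots> \<le> (1 / \<tau>)\<^sup>2 * (eucl_norm (mat_inv Hc *\<^sub>v x))\<^sup>2"
    using \<tau> by (intro mult_right_mono) (auto simp: power2_eq_square divide_simps mult_le_one)
  finally show "quad_multiplier (-1) 0 (?s\<^sup>2) (complex_of_real (- (1 / \<tau>)) \<cdot>\<^sub>m mat_inv Hc) x \<le> 0"
    unfolding quad_multiplier_smult_mat[OF K(1) x] by (simp add: power_mult_distrib)
qed

text \<open>Substituting \<open>z = T y\<close> turns the form of \<open>A\<close> into that of the
  diagonal matrix: a combination of the points \<open>cis (\<phi> ! k)\<close> weighted by the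
  squared moduli of the entries of \<open>z\<close>. As \<open>T\<close> is nonsingular,
  \<open>z\<close> is nonzero and the total weight is positive.\<close>

lemma is_phases_quad_form:
  assumes ph: "is_phases A \<phi>" and A: "dim_row A = n" and y: "y \<in> carrier_vec n" "y \<noteq> 0\<^sub>v n"
  obtains w where "\<And>k. w k \<ge> 0" "(\<Sum>k<n. w k) > 0"
    "quad_form A y = (\<Sum>k<n. complex_of_real (w k) * cis (\<phi> ! k))"
proof -
  let ?D = "mat_diag n (\<lambda>k. cis (\<phi> ! k))"
  obtain T where T: "T \<in> carrier_mat n n" "invertible_mat T" and AT: "A = mat_adjoint T * ?D * T"
    using ph A unfolding is_phases_def by auto
  define z where "z = T *\<^sub>v y"
  have z: "z \<in> carrier_vec n" using T y by (simp add: z_def)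
  have "z \<noteq> 0\<^sub>v n"
  proof
    assume z0: "z = 0\<^sub>v n"
    obtain S where "S * T = 1\<^sub>m (dim_row S)" "T * S = 1\<^sub>m n"
      using T unfolding invertible_mat_def inverts_mat_def by auto
    then have S: "S \<in> carrier_mat n n" "S * T = 1\<^sub>m n"
      using T by (metis carrier_matD(1) carrier_matD(2) carrier_mat_triv index_mult_mat(3) index_one_mat(3))+
    have "y = (S * T) *\<^sub>v y" using S y by simp
    also have "\<dots> = S *\<^sub>v z" using S(1) T y unfolding z_def by (simp only: assoc_mult_mat_vec[of _ n n _ n])
    finally show False using z0 S y by auto
  qed
  then have pos: "(\<Sum>k<n. (cmod (z $ k))\<^sup>2) > 0"
    using z eucl_norm_square[of z] eucl_norm_pos_iff[OF z] by (metis carrier_vecD zero_less_power)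
  have Dz: "(?D *\<^sub>v z) $ k = cis (\<phi> ! k) * z $ k" if "k < n" for k
  proof -
    have "(?D *\<^sub>v z) $ k = (\<Sum>j = 0..<n. (if k = j then cis (\<phi> ! j) else 0) * z $ j)"
      using that z by (simp add: mat_diag_def scalar_prod_def)
    also have "\<dots> = (\<Sum>j = 0..<n. if k = j then cis (\<phi> ! j) * z $ j else 0)"
      by (rule sum.cong) auto
    finally show ?thesis using that by simp
  qed
  have Dzc: "?D *\<^sub>v z \<in> carrier_vec n" using z by (intro mult_mat_vec_carrier[of _ n n]) auto
  have "A *\<^sub>v y = mat_adjoint T *\<^sub>v (?D *\<^sub>v z)"
    using T y unfolding AT z_def by (simp add: assoc_mult_mat_vec[of _ n n _ n])
  then have "quad_form A y = (?D *\<^sub>v z) \<bullet>c z"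
    unfolding quad_form_def using T y Dzc
    by (simp add: cscalar_prod_adjoint[of _ n n] z_def)
  also have "\<dots> = (\<Sum>k<n. cis (\<phi> ! k) * (z $ k * cnj (z $ k)))"
    using z Dz by (simp add: scalar_prod_def lessThan_atLeast0 mult_ac)
  also have "\<dots> = (\<Sum>k<n. complex_of_real ((cmod (z $ k))\<^sup>2) * cis (\<phi> ! k))"
    by (simp add: complex_norm_square mult_ac del: of_real_power)
  finally show thesis using that[of "\<lambda>k. (cmod (z $ k))\<^sup>2"] pos by auto
qed

text \<open>After rotation by an angle \<open>- d\<close> all phases of all blocks lie strictly
  between - pi / 2 and pi / 2, so the blocks have forms with positive real part. As \<open>d\<close>
  itself stays in [- pi / 2, pi / 2], the nonpositive real axis, where the form of
  \<open>- (1 / \<tau>) K\<close> lives, lands in the closed left half-plane.\<close>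

lemma phase_multiplier:
  assumes As: "\<forall>A \<in> set As. square_mat A \<and> dim_row A > 0" "As \<noteq> []"
    and phases: "\<forall>A \<in> set As. is_phases A (phases A)"
    and K: "K \<in> carrier_mat m m" "\<And>x. x \<in> carrier_vec m \<Longrightarrow> Re (quad_form K x) \<ge> 0 \<and> Im (quad_form K x) = 0"
    and \<tau>: "0 < \<tau>"
    and phase: "phase_condition As"
  shows "\<exists>a b c.
      (\<forall>A \<in> set As. \<forall>y \<in> carrier_vec (dim_row A). y \<noteq> 0\<^sub>v (dim_row A) \<longrightarrow> 0 < quad_multiplier a b c A y) \<and>
      (\<forall>x \<in> carrier_vec m. quad_multiplier a b c (complex_of_real (- (1 / \<tau>)) \<cdot>\<^sub>m K) x \<le> 0)"
proof -
  define p q where "p = Max (phase_max ` set As)" and "q = Min (phase_min ` set As)"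
  have pq: "p < pi" "q > - pi" "p - q < pi"
    using phase by (auto simp: phase_condition_def p_def q_def)
  \<comment> \<open>The midpoint of \<open>[q, p]\<close>, clipped to [- pi / 2, pi / 2]. Where
    clipping acts, \<open>p < pi\<close> or \<open>q > - pi\<close> supplies the margin that
    \<open>p - q < pi\<close> gives at the midpoint.\<close>
  define d where "d = max (- pi / 2) (min (pi / 2) ((p + q) / 2))"
  have d: "- pi / 2 \<le> d" "d \<le> pi / 2" "p - d < pi / 2" "d - q < pi / 2"
    using pq by (auto simp: d_def max_def min_def)
  have rot: "Re (cis (- d) * complex_of_real w * cis t) = w * cos (t - d)" for w t
    by (simp add: cos_diff algebra_simps)
  show ?thesis
  proof (intro exI conjI ballI impI)
    fix A and y :: "complex vec" assume A: "A \<in> set As" and y: "y \<in> carrier_vec (dim_row A)" "y \<noteq> 0\<^sub>v (dim_row A)"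
    let ?n = "dim_row A"
    have ph: "is_phases A (phases A)" using phases A by blast
    obtain w where w: "\<And>k. w k \<ge> 0" "(\<Sum>k<?n. w k) > 0"
      "quad_form A y = (\<Sum>k<?n. complex_of_real (w k) * cis (phases A ! k))"
      using is_phases_quad_form[OF ph refl y] by metis
    have len: "length (phases A) = ?n" and sorted: "sorted_wrt (\<ge>) (phases A)"
      using ph by (auto simp: is_phases_def)
    have cos: "cos (phases A ! k - d) > 0" if k: "k < ?n" for k
    proof -
      \<comment> \<open>The list is descending, so its ends \<open>phase_max A\<close> and
        \<open>phase_min A\<close> bound every entry.\<close>
      have "phases A ! k \<le> phases A ! 0" "phases A ! (?n - 1) \<le> phases A ! k"
        using sorted k len sorted_wrt_iff_nth_less[of "(\<ge>)" "phases A"]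
        by (metis le_eq_less_or_eq linorder_not_less not_gr_zero order_refl,
            metis Suc_pred' diff_less gr_implies_not0 less_SucE less_one linorder_neqE_nat order_refl zero_less_one)
      moreover have "phases A ! 0 = phase_max A" "phases A ! (?n - 1) = phase_min A"
        using hd_conv_nth[of "phases A"] last_conv_nth[of "phases A"] k len
        by (fastforce simp: phase_max_def phase_min_def)+
      moreover have "phase_max A \<le> p" "q \<le> phase_min A" using A by (auto simp: p_def q_def)
      ultimately have "phases A ! k \<le> p" "q \<le> phases A ! k" by auto
      then show ?thesis using d by (intro cos_gt_zero_pi) auto
    qed
    have "quad_multiplier 0 (cis (- d)) 0 A y = (\<Sum>k<?n. w k * cos (phases A ! k - d))"
      unfolding quad_multiplier_def w(3) sum_distrib_left
      by (simp only: mult.assoc[symmetric] Re_sum rot mult_zero_left add_0 add_0_right)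
    also have "\<dots> > 0"
    proof -
      obtain k where k: "k < ?n" "w k > 0"
        using w(1,2) by (metis lessThan_iff linorder_not_less sum_nonpos)
      have "w k * cos (phases A ! k - d) \<le> (\<Sum>k<?n. w k * cos (phases A ! k - d))"
        using w(1) cos k(1) by (intro member_le_sum) (auto simp: less_imp_le)
      moreover have "w k * cos (phases A ! k - d) > 0" using k cos by simp
      ultimately show ?thesis by linarith
    qed
    finally show "0 < quad_multiplier 0 (cis (- d)) 0 A y" .
  next
    fix x :: "complex vec" assume x: "x \<in> carrier_vec m"
    have "cos d \<ge> 0" using d by (intro cos_ge_zero) auto
    then have "0 \<le> (1 / \<tau>) * (cos d * Re (quad_form K x))"
      using \<tau> K(2)[OF x] by simp
    then show "quad_multiplier 0 (cis (- d)) 0 (complex_of_real (- (1 / \<tau>)) \<cdot>\<^sub>m K) x \<le> 0"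
      unfolding quad_multiplier_smult_mat[OF K(1) x] using K(2)[OF x] by simp
  qed
qed

section \<open>The graph condition\<close>

text \<open>Mixing two eigenvectors with squared coefficients \<open>\<alpha>\<close> and
  \<open>1 - \<alpha>\<close> attains every point of the chord between
  \<open>(l i, (l i)\<^sup>2)\<close> and \<open>(l j, (l j)\<^sup>2)\<close>. For
  \<open>i = j\<close> the two coefficients would occupy one coordinate, so the degenerate case is
  restricted to \<open>\<alpha> = 1\<close>.\<close>

lemma spectral_interpolation:
  fixes l :: "nat \<Rightarrow> real"
  assumes U: "U \<in> carrier_mat n n" "mat_adjoint U * U = 1\<^sub>m n"
    and K: "K = U * mat_diag n (\<lambda>k. complex_of_real (l k)) * mat_adjoint U"
    and ij: "i < n" "j < n" and \<alpha>: "0 \<le> \<alpha>" "\<alpha> \<le> 1" and ne: "l i = l j \<Longrightarrow> \<alpha> = 1"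
  obtains x where "x \<in> unit_vecs_of n"
    "Re (quad_form K x) = \<alpha> * l i + (1 - \<alpha>) * l j"
    "(eucl_norm (K *\<^sub>v x))\<^sup>2 = \<alpha> * (l i)\<^sup>2 + (1 - \<alpha>) * (l j)\<^sup>2"
proof -
  define y where "y = vec n (\<lambda>k. complex_of_real (if k = i then sqrt \<alpha> else if k = j then sqrt (1 - \<alpha>) else 0))"
  have y: "y \<in> carrier_vec n" by (simp add: y_def)
  define x where "x = U *\<^sub>v y"
  have x: "x \<in> carrier_vec n" using U y by (simp add: x_def)
  have yx: "mat_adjoint U *\<^sub>v x = y"
    using U y unfolding x_def by (simp flip: assoc_mult_mat_vec[of _ n n _ n])
  have sum: "(\<Sum>k<n. f (l k) * (cmod (y $ k))\<^sup>2) = \<alpha> * f (l i) + (1 - \<alpha>) * f (l j)" for f :: "real \<Rightarrow> real"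
  proof -
    have "(\<Sum>k<n. f (l k) * (cmod (y $ k))\<^sup>2) =
      (\<Sum>k<n. (if k = i then \<alpha> * f (l i) else 0) + (if k = j \<and> i \<noteq> j then (1 - \<alpha>) * f (l j) else 0))"
      using \<alpha> by (intro sum.cong refl) (auto simp: y_def)
    also have "\<dots> = \<alpha> * f (l i) + (if i \<noteq> j then (1 - \<alpha>) * f (l j) else 0)"
      using ij by (simp add: sum.distrib)
    finally show ?thesis using ne by auto
  qed
  note forms = unitary_spectral_forms[OF U K x, unfolded yx]
  show thesis
  proof (rule that[of x])
    have "(eucl_norm x)\<^sup>2 = 1" using sum[of "\<lambda>_. 1"] forms(3) by simp
    then show "x \<in> unit_vecs_of n"
      using x by (simp add: unit_vecs_of_def power2_eq_1_iff) (smt (verit) eucl_norm_nonneg)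
    show "Re (quad_form K x) = \<alpha> * l i + (1 - \<alpha>) * l j"
      unfolding forms(1) using sum[of "\<lambda>t. t"] by simp
    show "(eucl_norm (K *\<^sub>v x))\<^sup>2 = \<alpha> * (l i)\<^sup>2 + (1 - \<alpha>) * (l j)\<^sup>2"
      unfolding forms(2) using sum[of "\<lambda>t. t\<^sup>2"] by simp
  qed
qed

text \<open>
  Increasing \<open>t\<close> to a root \<open>t'\<close> of the quadratic puts \<open>(- X / t', Z / t'\<^sup>2)\<close> on the chord of the
  parabola \<open>v = u\<^sup>2\<close> over \<open>[p, q]\<close>, whose points are attained by combinations of two eigenvectors.
\<close>

lemma rescale_to_chord:
  fixes p q X Z t :: real
  assumes p: "0 < p" "p \<le> q" and t: "1 \<le> t" and XZ: "X\<^sup>2 \<le> Z"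
    and le: "Z + (p + q) * t * X + p * q * t\<^sup>2 \<le> 0"
  obtains t' \<alpha> where "1 \<le> t'" "0 \<le> \<alpha>" "\<alpha> \<le> 1" "p = q \<Longrightarrow> \<alpha> = 1"
    "X = - t' * (\<alpha> * p + (1 - \<alpha>) * q)" "Z = t'\<^sup>2 * (\<alpha> * p\<^sup>2 + (1 - \<alpha>) * q\<^sup>2)"
proof -
  define f where "f r = Z + (p + q) * r * X + p * q * r\<^sup>2" for r
  \<comment> \<open>From this size on, the quadratic term of \<open>f\<close> dominates the linear
    one. So \<open>f\<close> is nonnegative at \<open>T\<close> and has a root in
    \<open>[t, T]\<close>.\<close>
  define T where "T = max t (\<bar>(p + q) * X\<bar> / (p * q))"
  have pq: "p * q > 0" using p by simp
  have "T > 0" using t by (simp add: T_def)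
  have "\<bar>(p + q) * X\<bar> \<le> p * q * T"
    using p by (simp add: T_def max_def divide_simps mult_ac)
  then have "\<bar>(p + q) * X\<bar> * T \<le> p * q * T * T"
    using \<open>T > 0\<close> by (intro mult_right_mono) auto
  moreover have "- ((p + q) * X * T) \<le> \<bar>(p + q) * X\<bar> * T"
    using \<open>T > 0\<close> by (metis abs_ge_minus_self less_imp_le minus_mult_left mult_right_mono)
  moreover have "f T = Z + (p + q) * X * T + p * q * T * T"
    by (simp add: f_def power2_eq_square)
  moreover have "Z \<ge> 0" using XZ zero_le_power2[of X] by linarith
  ultimately have "f T \<ge> 0" by linarith
  moreover have "continuous_on {t..T} f" unfolding f_def by (intro continuous_intros)
  moreover have "f t \<le> 0" using le by (simp add: f_def)
  ultimately obtain t' where t': "t \<le> t'" "f t' = 0"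
    using IVT'[of f t 0 T] by (auto simp: T_def)
  then have "t' > 0" using t by simp
  \<comment> \<open>The abscissa after division by \<open>- t'\<close>. Since
    \<open>f t' = 0\<close>, the inequality \<open>X\<^sup>2 \<le> Z\<close> becomes
    \<open>(u - p) * (u - q) \<le> 0\<close>.\<close>
  define u where "u = - X / t'"
  have X: "X = - t' * u" using \<open>t' > 0\<close> by (simp add: u_def)
  have Z: "Z = t'\<^sup>2 * ((p + q) * u - p * q)"
    using t'(2) unfolding f_def X by (simp add: power2_eq_square algebra_simps)
  have "t'\<^sup>2 * u\<^sup>2 \<le> t'\<^sup>2 * ((p + q) * u - p * q)"
    using XZ unfolding Z by (simp add: X power_mult_distrib)
  then have "u\<^sup>2 \<le> (p + q) * u - p * q"
    using \<open>t' > 0\<close> by (simp only: mult_le_cancel_left_pos zero_less_power)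
  then have "(u - p) * (u - q) \<le> 0"
    by (simp add: power2_eq_square algebra_simps)
  then have u: "p \<le> u" "u \<le> q" using p(2) by (auto simp: mult_le_0_iff)
  \<comment> \<open>The weight of \<open>p\<close> when \<open>u\<close> is written as a convex
    combination of \<open>p\<close> and \<open>q\<close>; for \<open>p = q\<close> the value 1 is
    the one that \<open>spectral_interpolation\<close> accepts.\<close>
  define \<alpha> where "\<alpha> = (if p = q then 1 else (q - u) / (q - p))"
  have \<alpha>: "0 \<le> \<alpha>" "\<alpha> \<le> 1" using u by (auto simp: \<alpha>_def divide_simps)
  have ua: "u = \<alpha> * p + (1 - \<alpha>) * q"
  proof (cases "p = q")
    case True
    then show ?thesis using u by (simp add: \<alpha>_def)
  next
    case False
    then have "\<alpha> * (q - p) = q - u" by (simp add: \<alpha>_def)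
    then show ?thesis by (simp add: algebra_simps)
  qed
  have "(p + q) * u - p * q = \<alpha> * p\<^sup>2 + (1 - \<alpha>) * q\<^sup>2"
    unfolding ua by (simp add: power2_eq_square algebra_simps)
  then show thesis
    using that[of t' \<alpha>] t'(1) t \<alpha> X Z ua by (auto simp: \<alpha>_def)
qed

text \<open>If the form failed to be positive on a block, \<open>rescale_to_chord\<close> would put
  a graph point of the block on the graph of \<open>- t'\<close> times \<open>mat_inv Hc\<close>
  with \<open>t' \<ge> 1\<close>, against separation at the parameter \<open>1 / t'\<close>. This
  parameter may differ from \<tau>, so separation over the whole range enters. On
  \<open>- (1 / \<tau>)\<close> times \<open>mat_inv Hc\<close> the form is a nonnegative
  combination of products of one nonnegative and one nonpositive factor.\<close>

lemma xz_multiplier: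
  assumes As: "\<forall>A \<in> set As. square_mat A \<and> dim_row A > 0"
    and K: "mat_inv Hc \<in> carrier_mat m m" "mat_adjoint (mat_inv Hc) = mat_inv Hc" "m > 0"
    and pos: "\<And>x. x \<in> carrier_vec m \<Longrightarrow> x \<noteq> 0\<^sub>v m \<Longrightarrow> Re (quad_form (mat_inv Hc) x) > 0"
    and \<tau>: "0 < \<tau>" "\<tau> \<le> 1"
    and xz: "xz_condition As Hc"
  shows "\<exists>a b c.
      (\<forall>A \<in> set As. \<forall>y \<in> carrier_vec (dim_row A). y \<noteq> 0\<^sub>v (dim_row A) \<longrightarrow> 0 < quad_multiplier a b c A y) \<and>
      (\<forall>x \<in> carrier_vec m. quad_multiplier a b c (complex_of_real (- (1 / \<tau>)) \<cdot>\<^sub>m mat_inv Hc) x \<le> 0)"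
proof -
  let ?K = "mat_inv Hc"
  obtain U and l :: "nat \<Rightarrow> real" where U: "U \<in> carrier_mat m m" "mat_adjoint U * U = 1\<^sub>m m"
    and KU: "?K = U * mat_diag m (\<lambda>k. complex_of_real (l k)) * mat_adjoint U"
    using hermitian_spectral[OF K(1,2)] by metis
  have fin: "finite (l ` {..<m})" "l ` {..<m} \<noteq> {}" using K(3) by auto
  obtain i where i: "i < m" "l i = Min (l ` {..<m})" using Min_in[OF fin] by auto
  obtain j where j: "j < m" "l j = Max (l ` {..<m})" using Max_in[OF fin] by auto
  have lk: "l i \<le> l k" "l k \<le> l j" if "k < m" for k using that fin i j by auto
  have li: "0 < l i"
  proof -
    obtain x where x: "x \<in> unit_vecs_of m" "Re (quad_form ?K x) = l i"
      using spectral_interpolation[OF U KU i(1) i(1), of 1] by auto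
    then have "x \<in> carrier_vec m" "x \<noteq> 0\<^sub>v m"
      by (auto simp: unit_vecs_of_def eucl_norm_def)
    then show ?thesis using pos[of x] x(2) by simp
  qed
  let ?t = "1 / \<tau>"
  have t: "1 \<le> ?t" using \<tau> by simp
  let ?b = "complex_of_real ((l i + l j) * ?t)" and ?c = "l i * l j * ?t\<^sup>2"
  show ?thesis
  proof (intro exI conjI ballI impI)
    fix A and y :: "complex vec" assume A: "A \<in> set As" and y: "y \<in> carrier_vec (dim_row A)" "y \<noteq> 0\<^sub>v (dim_row A)"
    let ?n = "dim_row A"
    have Ac: "A \<in> carrier_mat ?n ?n" using As A by (auto intro!: carrier_matI)
    let ?d = "complex_of_real (1 / eucl_norm y)"
    define z where "z = ?d \<cdot>\<^sub>v y"
    have z: "z \<in> unit_vecs_of ?n" unfolding z_def by (rule unit_vecs_of_normalize[OF y])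
    define X Z where "X = Re (quad_form A z)" and "Z = (eucl_norm (A *\<^sub>v z))\<^sup>2"
    have XZ: "X\<^sup>2 \<le> Z" unfolding X_def Z_def by (rule quad_form_le_eucl_norm[OF Ac z])
    have XZA: "(X, Z) \<in> xz_graph A" using z by (auto simp: xz_graph_def X_def Z_def)
    have "Z + (l i + l j) * ?t * X + l i * l j * ?t\<^sup>2 > 0"
    proof (rule ccontr)
      assume "\<not> ?thesis"
      then have "Z + (l i + l j) * ?t * X + l i * l j * ?t\<^sup>2 \<le> 0" by simp
      from rescale_to_chord[OF li lk(2)[OF i(1)] t XZ this]
      obtain t' \<alpha> where t': "1 \<le> t'" "0 \<le> \<alpha>" "\<alpha> \<le> 1" "l i = l j \<Longrightarrow> \<alpha> = 1"
        "X = - t' * (\<alpha> * l i + (1 - \<alpha>) * l j)" "Z = t'\<^sup>2 * (\<alpha> * (l i)\<^sup>2 + (1 - \<alpha>) * (l j)\<^sup>2)"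
        by metis
      obtain x where x: "x \<in> unit_vecs_of m" "Re (quad_form ?K x) = \<alpha> * l i + (1 - \<alpha>) * l j"
        "(eucl_norm (?K *\<^sub>v x))\<^sup>2 = \<alpha> * (l i)\<^sup>2 + (1 - \<alpha>) * (l j)\<^sup>2"
        using spectral_interpolation[OF U KU i(1) j(1) t'(2,3,4)] by metis
      have xc: "x \<in> carrier_vec m" using x by (simp add: unit_vecs_of_def)
      \<comment> \<open>The double reciprocal matches the shape of \<open>xz_condition\<close> at
        the parameter \<open>1 / t'\<close>.\<close>
      let ?M = "complex_of_real (- (1 / (1 / t'))) \<cdot>\<^sub>m ?K"
      \<comment> \<open>The two coordinates are the forms with coefficients (0, 1, 0) and (1, 0,
        0).\<close>
      have "Re (quad_form ?M x) = X" "(eucl_norm (?M *\<^sub>v x))\<^sup>2 = Z"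
        using quad_multiplier_smult_mat[OF K(1) xc, of 0 1 0 "- t'"]
          quad_multiplier_smult_mat[OF K(1) xc, of 1 0 0 "- t'"] x t'
        by (simp_all add: quad_multiplier_def)
      then have "(X, Z) \<in> xz_graph ?M"
        using x(1) K(1) unfolding xz_graph_def by (auto intro!: image_eqI[of _ _ x])
      moreover have "0 < 1 / t'" "1 / t' \<le> 1" using t'(1) by auto
      then have "xz_graph A \<inter> xz_graph ?M = {}"
        using xz A unfolding xz_condition_def by blast
      ultimately show False using XZA by blast
    qed
    moreover have "quad_multiplier 1 ?b ?c A z = Z + (l i + l j) * ?t * X + l i * l j * ?t\<^sup>2"
      using z by (simp add: quad_multiplier_def X_def Z_def unit_vecs_of_def)
    ultimately have "0 < quad_multiplier 1 ?b ?c A z" by simp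
    then show "0 < quad_multiplier 1 ?b ?c A y"
      unfolding z_def quad_multiplier_smult[OF Ac y(1)] by (simp add: zero_less_mult_iff)
  next
    fix x :: "complex vec" assume x: "x \<in> carrier_vec m"
    define w where "w k = (cmod ((mat_adjoint U *\<^sub>v x) $ k))\<^sup>2" for k
    note forms = unitary_spectral_forms[OF U KU x, folded w_def]
    \<comment> \<open>\<open>S r\<close> is the spectral moment of order \<open>r\<close> of
      \<open>x\<close>: the squared norm, the form of \<open>?K\<close> and the squared norm of the
      image for \<open>r\<close> = 0, 1 and 2.\<close>
    define S where "S r = (\<Sum>k<m. (l k) ^ r * w k)" for r
    have "(\<Sum>k<m. (l k - l i) * (l k - l j) * w k) =
      (\<Sum>k<m. (l k)\<^sup>2 * w k - (l i + l j) * (l k * w k) + l i * l j * w k)"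
      by (intro sum.cong refl) (simp add: power2_eq_square algebra_simps)
    also have "\<dots> = S 2 - (l i + l j) * S 1 + l i * l j * S 0"
      by (simp add: S_def sum.distrib sum_subtractf sum_distrib_left)
    finally have S: "(\<Sum>k<m. (l k - l i) * (l k - l j) * w k) = S 2 - (l i + l j) * S 1 + l i * l j * S 0" .
    have "quad_multiplier 1 ?b ?c (complex_of_real (- ?t) \<cdot>\<^sub>m ?K) x =
      ?t\<^sup>2 * S 2 - ?t * ((l i + l j) * ?t * S 1) + ?c * S 0"
      unfolding quad_multiplier_smult_mat[OF K(1) x] forms by (simp add: S_def)
    also have "\<dots> = ?t\<^sup>2 * (\<Sum>k<m. (l k - l i) * (l k - l j) * w k)"
      unfolding S by (simp add: power2_eq_square algebra_simps add_divide_distrib)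
    also have "\<dots> \<le> 0"
      using lk by (intro mult_nonneg_nonpos sum_nonpos mult_nonpos_nonneg) (auto simp: mult_le_0_iff w_def)
    finally show "quad_multiplier 1 ?b ?c (complex_of_real (- ?t) \<cdot>\<^sub>m ?K) x \<le> 0" .
  qed
qed

section \<open>Phases of sectorial matrices\<close>

lemma quad_form_pencil:
  assumes A: "A \<in> carrier_mat n n" and x: "x \<in> carrier_vec n" and y: "y \<in> carrier_vec n"
  shows "quad_form A (a \<cdot>\<^sub>v x + b \<cdot>\<^sub>v y) =
    complex_of_real ((cmod a)\<^sup>2) * quad_form A x + complex_of_real ((cmod b)\<^sup>2) * quad_form A y +
    (a * cnj b * ((A *\<^sub>v x) \<bullet>c y) + b * cnj a * ((A *\<^sub>v y) \<bullet>c x))"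
proof -
  have [simp]: "A *\<^sub>v x \<in> carrier_vec n" "A *\<^sub>v y \<in> carrier_vec n" using assms by auto
  have *: "A *\<^sub>v (a \<cdot>\<^sub>v x + b \<cdot>\<^sub>v y) = a \<cdot>\<^sub>v (A *\<^sub>v x) + b \<cdot>\<^sub>v (A *\<^sub>v y)"
    using assms by (simp add: mult_add_distrib_mat_vec[of _ n n] mult_mat_vec[of _ n n])
  have c: "conjugate (a \<cdot>\<^sub>v x + b \<cdot>\<^sub>v y) = cnj a \<cdot>\<^sub>v conjugate x + cnj b \<cdot>\<^sub>v conjugate y"
    using x y by (intro eq_vecI) auto
  show ?thesis
    unfolding quad_form_def * c using x y
    by (simp add: add_scalar_prod_distrib[of _ n] scalar_prod_add_distrib[of _ n]
        smult_scalar_prod_distrib[of _ n] scalar_prod_smult_distrib[of _ n] complex_norm_square algebra_simps del: of_real_power)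
qed

text \<open>A suitable unimodular \<mu> keeps the form on the real line spanned by \<open>c\<close>
  along the path \<open>(1 - s) x + s \<mu> y\<close>. There it moves from \<open>c * a\<close> to
  \<open>- c * b\<close>, so it vanishes at an intermediate \<open>s\<close>.\<close>

lemma quad_form_antipodal_zero:
  assumes A: "A \<in> carrier_mat n n" and x: "x \<in> carrier_vec n" and y: "y \<in> carrier_vec n"
    and c: "c \<noteq> 0" and a: "a > 0" "quad_form A x = c * complex_of_real a"
    and b: "b > 0" "quad_form A y = - c * complex_of_real b"
  obtains z where "z \<in> carrier_vec n" "z \<noteq> 0\<^sub>v n" "quad_form A z = 0"
proof -
  define P Q where "P = ((A *\<^sub>v x) \<bullet>c y) / c" and "Q = ((A *\<^sub>v y) \<bullet>c x) / c"
  \<comment> \<open>The imaginary part of \<open>cnj \<mu> * P + \<mu> * Q\<close> is that of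
    \<open>\<mu> * w\<close>, so \<open>\<mu>\<close> is chosen to rotate \<open>w\<close> onto the
    nonnegative real axis.\<close>
  define w where "w = Q - cnj P"
  define \<mu> where "\<mu> = (if w = 0 then 1 else cnj w / cmod w)"
  have \<mu>: "cmod \<mu> = 1" by (simp add: \<mu>_def norm_divide)
  have "Im (\<mu> * w) = 0"
  proof (cases "w = 0")
    case False
    then have "\<mu> * w = (w * cnj w) / cmod w" by (simp add: \<mu>_def)
    also have "\<dots> = complex_of_real ((cmod w)\<^sup>2 / cmod w)" 
      by (simp add: complex_norm_square del: of_real_power)
    finally show ?thesis by (metis Im_complex_of_real)
  qed simp
  then have "Im (cnj \<mu> * P + \<mu> * Q) = 0"
    by (simp add: w_def algebra_simps)
  then obtain r where r: "cnj \<mu> * P + \<mu> * Q = complex_of_real r"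
    by (metis complex_is_Real_iff Reals_cases)
  define g where "g s = (1 - s)\<^sup>2 * a - s\<^sup>2 * b + s * (1 - s) * r" for s :: real
  have "continuous_on {0..1} g" unfolding g_def by (intro continuous_intros)
  then obtain s where s: "0 \<le> s" "s \<le> 1" "g s = 0"
    using IVT2'[of g 1 0 0] a b by (auto simp: g_def)
  define z where "z = complex_of_real (1 - s) \<cdot>\<^sub>v x + (complex_of_real s * \<mu>) \<cdot>\<^sub>v y"
  have z: "z \<in> carrier_vec n" using x y by (simp add: z_def)
  have "quad_form A z = c * complex_of_real (g s)"
  proof -
    have "(A *\<^sub>v x) \<bullet>c y = c * P" "(A *\<^sub>v y) \<bullet>c x = c * Q" using c by (auto simp: P_def Q_def)
    then have "quad_form A z = c * (complex_of_real ((1 - s)\<^sup>2 * a - s\<^sup>2 * b) +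
        complex_of_real (s * (1 - s)) * (cnj \<mu> * P + \<mu> * Q))"
      unfolding z_def quad_form_pencil[OF A x y] a(2) b(2) norm_mult \<mu> norm_of_real mult_1_right power2_abs
      by (simp add: power_mult_distrib algebra_simps)
    then show ?thesis unfolding r g_def by simp
  qed
  then have "quad_form A z = 0" using s by simp
  \<comment> \<open>If \<open>z\<close> vanished, comparing the forms of the two opposite summands
    would give \<open>(1 - s)\<^sup>2 * a = - (s\<^sup>2 * b)\<close>, forcing both
    \<open>s = 1\<close> and \<open>s = 0\<close>.\<close>
  moreover have "z \<noteq> 0\<^sub>v n"
  proof
    assume z0: "z = 0\<^sub>v n"
    have "complex_of_real (1 - s) * x $ i = - (complex_of_real s * \<mu>) * y $ i" if "i < n" for i
      using arg_cong[OF z0, of "\<lambda>v. v $ i"] that x y unfolding z_def by (simp add: add_eq_0_iff)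
    then have "complex_of_real (1 - s) \<cdot>\<^sub>v x = (- (complex_of_real s * \<mu>)) \<cdot>\<^sub>v y"
      using x y by (intro eq_vecI) auto
    then have "quad_form A (complex_of_real (1 - s) \<cdot>\<^sub>v x) = quad_form A ((- (complex_of_real s * \<mu>)) \<cdot>\<^sub>v y)"
      by (rule arg_cong)
    then have "c * complex_of_real ((1 - s)\<^sup>2 * a) = c * complex_of_real (- (s\<^sup>2 * b))"
      unfolding quad_form_smult[OF A x] quad_form_smult[OF A y] a(2) b(2) norm_minus_cancel norm_mult \<mu> norm_of_real mult_1_right power2_abs
      by (simp add: algebra_simps)
    then have "(1 - s)\<^sup>2 * a = - (s\<^sup>2 * b)" using c by (simp only: mult_cancel_left of_real_eq_iff) simp
    moreover have "(1 - s)\<^sup>2 * a \<ge> 0" "s\<^sup>2 * b \<ge> 0" using a b by auto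
    ultimately have "(1 - s)\<^sup>2 * a = 0" "s\<^sup>2 * b = 0" by linarith+
    then show False using a b by simp
  qed
  ultimately show thesis using that z by blast
qed

text \<open>
  Toeplitz--Hausdorff: a point strictly between two values of the form of \<open>A\<close> sees them in opposite
  directions, hence is itself a value.
\<close>

lemma convex_numerical_range:
  assumes A: "A \<in> carrier_mat n n"
  shows "convex (numerical_range A)"
  unfolding convex_alt
proof (intro ballI allI impI)
  fix u v and t :: real assume uv: "u \<in> numerical_range A" "v \<in> numerical_range A" and t: "0 \<le> t \<and> t \<le> 1"
  define \<xi> where "\<xi> = (1 - t) *\<^sub>R u + t *\<^sub>R v"
  obtain x y where xy: "x \<in> unit_vecs_of n" "y \<in> unit_vecs_of n" and u: "u = quad_form A x" and v: "v = quad_form A y"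
    using uv A by (auto simp: numerical_range_def)
  have xyc: "x \<in> carrier_vec n" "y \<in> carrier_vec n" "eucl_norm x = 1" "eucl_norm y = 1"
    using xy by (auto simp: unit_vecs_of_def)
  show "\<xi> \<in> numerical_range A"
  proof (cases "u = v \<or> t = 0 \<or> t = 1")
    case True
    then have "\<xi> = u \<or> \<xi> = v" by (auto simp: \<xi>_def scaleR_conv_of_real algebra_simps)
    then show ?thesis using uv by auto
  next
    case False
    \<comment> \<open>The shift by \<open>\<xi>\<close> turns the search for a preimage of
      \<open>\<xi>\<close> into the search for a zero of the form of \<open>B\<close>.\<close>
    define B where "B = A + (- \<xi>) \<cdot>\<^sub>m 1\<^sub>m n"
    have B: "B \<in> carrier_mat n n" using A by (simp add: B_def)
    have qB: "quad_form B z = quad_form A z - \<xi> * complex_of_real ((eucl_norm z)\<^sup>2)" if z: "z \<in> carrier_vec n" for z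
    proof -
      have "B *\<^sub>v z = A *\<^sub>v z + (- \<xi>) \<cdot>\<^sub>v z"
        using A z unfolding B_def
        by (simp add: add_mult_distrib_mat_vec[of _ n n] smult_mat_mult_mat_vec_assoc[of _ n n])
      then have "quad_form B z = quad_form A z + (- \<xi>) * (z \<bullet>c z)"
        unfolding quad_form_def using A z by (simp add: add_scalar_prod_distrib[of _ n])
      then show ?thesis unfolding cscalar_prod_self by simp
    qed
    have "quad_form B x = (u - v) * complex_of_real t" "quad_form B y = - (u - v) * complex_of_real (1 - t)"
      using qB[OF xyc(1)] qB[OF xyc(2)] xyc u v
      by (auto simp: \<xi>_def scaleR_conv_of_real algebra_simps)
    then obtain z where z: "z \<in> carrier_vec n" "z \<noteq> 0\<^sub>v n" "quad_form B z = 0"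
      using quad_form_antipodal_zero[OF B xyc(1,2), of "u - v" t "1 - t"] False t by force
    let ?d = "complex_of_real (1 / eucl_norm z)"
    have zu: "?d \<cdot>\<^sub>v z \<in> unit_vecs_of n" by (rule unit_vecs_of_normalize[OF z(1,2)])
    have "quad_form B (?d \<cdot>\<^sub>v z) = 0" using quad_form_smult[OF B z(1)] z(3) by simp
    then have "quad_form A (?d \<cdot>\<^sub>v z) = \<xi>" using qB[of "?d \<cdot>\<^sub>v z"] zu by (simp add: unit_vecs_of_def)
    then show ?thesis using zu A unfolding numerical_range_def by (auto intro!: image_eqI[of _ _ "?d \<cdot>\<^sub>v z"])
  qed
qed

text \<open>The unit sphere is encoded by functions on \<open>nat\<close> that vanish from
  \<open>n\<close> on. It is a closed part of a product of compact sets, hence compact by Tychonoff,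
  and the numerical range is its image under a polynomial in the coordinates and their
  conjugates.\<close>

lemma compact_numerical_range:
  assumes A: "A \<in> carrier_mat n n"
  shows "compact (numerical_range A)"
proof -
  define S :: "(nat \<Rightarrow> complex) set" where
    "S = PiE UNIV (\<lambda>i. if i < n then cball 0 1 else {0}) \<inter> {f. (\<Sum>i<n. (cmod (f i))\<^sup>2) = 1}"
  define F where "F f = (\<Sum>i<n. \<Sum>j<n. A $$ (i, j) * f j * cnj (f i))" for f :: "nat \<Rightarrow> complex"
  have coord: "continuous_on UNIV (\<lambda>f :: nat \<Rightarrow> complex. f i)" for i
    by (rule continuous_on_product_coordinates)
  have "compact (PiE UNIV (\<lambda>i. if i < n then cball 0 1 else {0}) :: (nat \<Rightarrow> complex) set)"
  proof -
    have "compactin (product_topology (\<lambda>i. euclidean) UNIV)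
      (PiE UNIV (\<lambda>i. if i < n then cball 0 1 else {0}) :: (nat \<Rightarrow> complex) set)"
      unfolding compactin_PiE by auto
    then show ?thesis unfolding euclidean_product_topology by simp
  qed
  moreover have "closed {f :: nat \<Rightarrow> complex. (\<Sum>i<n. (cmod (f i))\<^sup>2) = 1}"
    by (intro closed_Collect_eq continuous_intros coord)
  ultimately have "compact S" unfolding S_def by (rule compact_Int_closed)
  moreover have "continuous_on S F"
    unfolding F_def by (intro continuous_intros continuous_on_subset[OF coord]) auto
  ultimately have "compact (F ` S)" by (rule compact_continuous_image[rotated])
  also have "F ` S = numerical_range A"
  proof (intro equalityI subsetI)
    fix w assume "w \<in> F ` S"
    then obtain f where f: "f \<in> S" "w = F f" by auto
    have "eucl_norm (vec n f) = 1" using f by (simp add: eucl_norm_def S_def)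
    then have "vec n f \<in> unit_vecs_of n" by (simp add: unit_vecs_of_def)
    moreover have "quad_form A (vec n f) = w"
      using A unfolding f(2) F_def by (subst quad_form_sum[of _ n]) auto
    ultimately show "w \<in> numerical_range A" using A unfolding numerical_range_def by auto
  next
    fix w assume "w \<in> numerical_range A"
    then obtain x where x: "x \<in> unit_vecs_of n" "w = quad_form A x"
      using A by (auto simp: numerical_range_def)
    then have xc: "x \<in> carrier_vec n" "(\<Sum>i<n. (cmod (x $ i))\<^sup>2) = 1"
      using eucl_norm_square[of x] by (auto simp: unit_vecs_of_def)
    define f where "f i = (if i < n then x $ i else 0)" for i
    have "cmod (x $ i) \<le> 1" if "i < n" for i
    proof -
      have "(cmod (x $ i))\<^sup>2 \<le> (\<Sum>i<n. (cmod (x $ i))\<^sup>2)" using that by (intro member_le_sum) auto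
      then show ?thesis using xc(2) by (simp add: abs_square_le_1)
    qed
    then have "f \<in> S" using xc(2) by (auto simp: S_def f_def)
    moreover have "F f = w" using A xc unfolding x(2) F_def f_def by (subst quad_form_sum[of _ n]) auto
    ultimately show "w \<in> F ` S" by auto
  qed
  finally show ?thesis .
qed

section \<open>Existence of phases\<close>

text \<open>The numerical range is compact, convex and misses 0, so a line separates it strictly
  from 0. The angle is the argument of a normal vector of that line.\<close>

lemma sectorial_half_plane:
  assumes A: "A \<in> carrier_mat n n" and sec: "sectorial A"
  obtains \<theta> where "\<And>x. x \<in> carrier_vec n \<Longrightarrow> x \<noteq> 0\<^sub>v n \<Longrightarrow> Re (cis (- \<theta>) * quad_form A x) > 0"
proof -
  obtain a b where ab: "a \<noteq> 0" "0 < b" "\<And>w. w \<in> numerical_range A \<Longrightarrow> b < inner a w"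
    using separating_hyperplane_closed_0[OF convex_numerical_range[OF A]
        compact_imp_closed[OF compact_numerical_range[OF A]]] sec
    unfolding sectorial_def by metis
  have "Re (cis (- Arg a) * quad_form A x) > 0" if x: "x \<in> carrier_vec n" "x \<noteq> 0\<^sub>v n" for x
  proof -
    let ?d = "complex_of_real (1 / eucl_norm x)"
    have "quad_form A (?d \<cdot>\<^sub>v x) \<in> numerical_range A"
      using unit_vecs_of_normalize[OF x] A unfolding numerical_range_def by auto
    then have "0 < inner a (quad_form A (?d \<cdot>\<^sub>v x))" using ab by force
    also have "\<dots> = (cmod ?d)\<^sup>2 * inner a (quad_form A x)"
      unfolding quad_form_smult[OF A x(1)] by (simp add: inner_complex_def algebra_simps)
    finally have "0 < inner a (quad_form A x)" by (simp add: zero_less_mult_iff)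
    also have "inner a (quad_form A x) = cmod a * Re (cis (- Arg a) * quad_form A x)"
    proof -
      have a: "a = cmod a * cis (Arg a)" using ab(1) by (simp add: cis_Arg complex_sgn_def scaleR_conv_of_real)
      have "Re a = cmod a * cos (Arg a)" "Im a = cmod a * sin (Arg a)"
        by (subst (1) a, simp)+
      then show ?thesis by (simp add: inner_complex_def algebra_simps)
    qed
    finally show ?thesis using ab(1) by (simp add: zero_less_mult_iff)
  qed
  then show thesis using that by blast
qed

lemma mat_diag_mult_mult:
  fixes S :: "complex mat"
  assumes S: "S \<in> carrier_mat n n"
  shows "mat_adjoint S * mat_diag n f * S =
    mat n n (\<lambda>(i, j). \<Sum>k<n. cnj (S $$ (k, i)) * f k * S $$ (k, j))"
proof -
  have S': "mat_adjoint S \<in> carrier_mat n n" using S by simp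
  show ?thesis unfolding mat_diag_mult_right[OF S'] using S
    by (intro eq_matI) (auto simp: scalar_prod_def lessThan_atLeast0)
qed

text \<open>In an eigenbasis of \<open>P\<close>, congruence by the inverse square root turns
  \<open>P\<close> into the identity and \<open>Q\<close> into a hermitian matrix \<open>R\<close>.
  A unitary \<open>W\<close> diagonalizing \<open>R\<close> leaves the identity unchanged, so
  undoing the congruence handles both matrices at once.\<close>

lemma simultaneous_congruence:
  fixes P Q :: "complex mat"
  assumes P: "P \<in> carrier_mat n n" "mat_adjoint P = P"
    and pos: "\<And>x. x \<in> carrier_vec n \<Longrightarrow> x \<noteq> 0\<^sub>v n \<Longrightarrow> Re (quad_form P x) > 0"
    and Q: "Q \<in> carrier_mat n n" "mat_adjoint Q = Q"
  obtains S and l :: "nat \<Rightarrow> real" where "S \<in> carrier_mat n n" "P = mat_adjoint S * S"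
    "Q = mat_adjoint S * mat_diag n (\<lambda>k. complex_of_real (l k)) * S"
proof -
  obtain V and p :: "nat \<Rightarrow> real" where V: "V \<in> carrier_mat n n" "mat_adjoint V * V = 1\<^sub>m n"
    and PV: "P = V * mat_diag n (\<lambda>k. complex_of_real (p k)) * mat_adjoint V"
    using hermitian_spectral[OF P] by metis
  have VV: "V * mat_adjoint V = 1\<^sub>m n" by (rule unitary_mult_adjoint[OF V])
  have p: "p k > 0" if k: "k < n" for k
  proof -
    obtain x where x: "x \<in> unit_vecs_of n" "Re (quad_form P x) = p k"
      using spectral_interpolation[OF V PV k k, of 1] by auto
    then have "x \<in> carrier_vec n" "x \<noteq> 0\<^sub>v n" by (auto simp: unit_vecs_of_def eucl_norm_def)
    then show ?thesis using pos[of x] x(2) by simp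
  qed
  \<comment> \<open>The positive square root of \<open>P\<close> and its inverse, written in the
    eigenbasis \<open>V\<close>.\<close>
  define E F where "E = mat_diag n (\<lambda>k. complex_of_real (sqrt (p k)))"
    and "F = mat_diag n (\<lambda>k. complex_of_real (1 / sqrt (p k)))"
  have EF: "E \<in> carrier_mat n n" "F \<in> carrier_mat n n" by (auto simp: E_def F_def)
  have adj: "mat_adjoint E = E" "mat_adjoint F = F"
    by (simp_all add: E_def F_def mat_adjoint_mat_diag)
  have one: "mat_diag n (\<lambda>k. complex_of_real (sqrt (p k)) * complex_of_real (1 / sqrt (p k))) = 1\<^sub>m n"
    using p by (intro eq_matI) (fastforce simp: mat_diag_def)+
  then have "E * F = 1\<^sub>m n" "F * E = 1\<^sub>m n"
    unfolding E_def F_def by (simp_all only: mat_diag_diag mult.commute)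
  have EE: "E * E = mat_diag n (\<lambda>k. complex_of_real (p k))"
    unfolding E_def mat_diag_diag
    using p by (intro eq_matI) (auto simp: mat_diag_def less_imp_le simp flip: of_real_mult)
  define R where "R = F * (mat_adjoint V * Q * V) * F"
  have R: "R \<in> carrier_mat n n" using EF V Q by (simp add: R_def)
  have "mat_adjoint R = R"
    unfolding R_def using EF V Q adj
    by (simp add: mat_adjoint_mult assoc_mult_mat[of _ n n _ n _ n])
  then obtain W and l :: "nat \<Rightarrow> real" where W: "W \<in> carrier_mat n n" "mat_adjoint W * W = 1\<^sub>m n"
    and RW: "R = W * mat_diag n (\<lambda>k. complex_of_real (l k)) * mat_adjoint W"
    using hermitian_spectral[OF R] by metis
  have WW: "W * mat_adjoint W = 1\<^sub>m n" by (rule unitary_mult_adjoint[OF W])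
  let ?L = "mat_diag n (\<lambda>k. complex_of_real (l k))"
  define S where "S = mat_adjoint W * E * mat_adjoint V"
  have S: "S \<in> carrier_mat n n" using W V EF by (simp add: S_def)
  have S': "mat_adjoint S = V * E * W"
    unfolding S_def using W V EF adj by (simp add: mat_adjoint_mult assoc_mult_mat[of _ n n _ n _ n])
  have "mat_adjoint S * S = V * (E * (W * mat_adjoint W) * E) * mat_adjoint V"
    unfolding S' unfolding S_def using W(1) V(1) EF by (simp add: assoc_mult_mat[of _ n n _ n _ n])
  also have "\<dots> = P" unfolding WW PV using EF EE by simp
  finally have "P = mat_adjoint S * S" by simp
  moreover have "mat_adjoint S * ?L * S = V * (E * (W * ?L * mat_adjoint W) * E) * mat_adjoint V"
    unfolding S' unfolding S_def using W(1) V(1) EF by (simp add: assoc_mult_mat[of _ n n _ n _ n])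
  then have "mat_adjoint S * ?L * S = V * ((E * F) * (mat_adjoint V * Q * V) * (F * E)) * mat_adjoint V"
    unfolding RW[symmetric] R_def using Q(1) V(1) EF by (simp add: assoc_mult_mat[of _ n n _ n _ n])
  then have "mat_adjoint S * ?L * S = V * (mat_adjoint V * Q * V) * mat_adjoint V"
    unfolding \<open>E * F = 1\<^sub>m n\<close> \<open>F * E = 1\<^sub>m n\<close> using Q(1) V(1) by simp
  then have "mat_adjoint S * ?L * S = (V * mat_adjoint V) * Q * (V * mat_adjoint V)"
    using Q(1) V(1) by (simp add: assoc_mult_mat[of _ n n _ n _ n])
  then have "Q = mat_adjoint S * ?L * S" unfolding VV using Q(1) by simp
  ultimately show thesis using that S by blast
qed

text \<open>Rotated into the right half-plane, the matrix is \<open>P + \<i> Q\<close> with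
  \<open>Q\<close> hermitian and \<open>P\<close> positive definite, hence congruent to the diagonal
  matrix with entries \<open>1 + \<i> * l k\<close>. Their arguments \<open>arctan (l k)\<close> lie
  strictly between - pi / 2 and pi / 2, which bounds the spread of the phases. This justifies the
  choice in \<open>phases\<close>.\<close>

lemma sectorial_is_phases:
  assumes A: "A \<in> carrier_mat n n" and n: "n > 0" and sec: "sectorial A"
  shows "\<exists>\<phi>. is_phases A \<phi>"
proof -
  obtain \<theta> where \<theta>: "\<And>x. x \<in> carrier_vec n \<Longrightarrow> x \<noteq> 0\<^sub>v n \<Longrightarrow> Re (cis (- \<theta>) * quad_form A x) > 0"
    using sectorial_half_plane[OF A sec] by metis
  define B where "B = cis (- \<theta>) \<cdot>\<^sub>m A"
  have B: "B \<in> carrier_mat n n" using A by (simp add: B_def)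
  define P Q where "P = (1 / 2) \<cdot>\<^sub>m (B + mat_adjoint B)"
    and "Q = (- \<i> / 2) \<cdot>\<^sub>m (B + (- 1) \<cdot>\<^sub>m mat_adjoint B)"
  have PQ: "P \<in> carrier_mat n n" "Q \<in> carrier_mat n n" using B by (auto simp: P_def Q_def)
  have herm: "mat_adjoint P = P" "mat_adjoint Q = Q"
    using B by (auto simp: P_def Q_def algebra_simps intro!: eq_matI)
  have BPQ: "B $$ (i, j) = P $$ (i, j) + \<i> * Q $$ (i, j)" if "i < n" "j < n" for i j
    using B that by (simp add: P_def Q_def field_simps)
  have "Re (quad_form P x) > 0" if x: "x \<in> carrier_vec n" "x \<noteq> 0\<^sub>v n" for x
  proof -
    have Bx: "B *\<^sub>v x \<in> carrier_vec n" "mat_adjoint B *\<^sub>v x \<in> carrier_vec n" using B x by auto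
    have "P *\<^sub>v x = (1 / 2) \<cdot>\<^sub>v (B *\<^sub>v x + mat_adjoint B *\<^sub>v x)"
      unfolding P_def using B x
      by (simp add: smult_mat_mult_mat_vec_assoc[of _ n n] add_mult_distrib_mat_vec[of _ n n])
    then have "quad_form P x = (1 / 2) * ((B *\<^sub>v x) \<bullet>c x + (mat_adjoint B *\<^sub>v x) \<bullet>c x)"
      unfolding quad_form_def using x Bx
      by (simp add: smult_scalar_prod_distrib[of _ n] add_scalar_prod_distrib[of _ n])
    also have "(mat_adjoint B *\<^sub>v x) \<bullet>c x = x \<bullet>c (B *\<^sub>v x)"
      using B x by (subst cscalar_prod_adjoint[of _ n n]) auto
    also have "x \<bullet>c (B *\<^sub>v x) = cnj ((B *\<^sub>v x) \<bullet>c x)"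
    proof -
      have "u \<bullet>c v = cnj (v \<bullet>c u)" if "dim_vec u = dim_vec v" for u v :: "complex vec"
        using that by (simp add: scalar_prod_def mult_ac)
      from this[of x "B *\<^sub>v x"] show ?thesis using x Bx by (metis carrier_vecD)
    qed
    finally have "quad_form P x = (1 / 2) * (quad_form B x + cnj (quad_form B x))"
      by (simp only: quad_form_def)
    then have "Re (quad_form P x) = Re (quad_form B x)"
      by (simp only: complex_add_cnj) simp
    also have "quad_form B x = cis (- \<theta>) * quad_form A x"
      unfolding quad_form_def B_def using A x
      by (simp add: smult_mat_mult_mat_vec_assoc[of _ n n])
    finally show ?thesis using \<theta>[OF x] by simp
  qed
  then obtain S and l :: "nat \<Rightarrow> real" where S: "S \<in> carrier_mat n n" and PS: "P = mat_adjoint S * S"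
    and QS: "Q = mat_adjoint S * mat_diag n (\<lambda>k. complex_of_real (l k)) * S"
    using simultaneous_congruence[OF PQ(1) herm(1) _ PQ(2) herm(2)] by metis
  \<comment> \<open>The phases relative to \<theta> in descending order; the permutation
    \<open>\<pi>\<close> below records the sorting.\<close>
  define g where "g = rev (sort (map (\<lambda>k. arctan (l k)) [0..<n]))"
  have len: "length g = n" by (simp add: g_def)
  then have gne: "g \<noteq> []" using n by auto
  have "mset g = mset (map (\<lambda>k. arctan (l k)) [0..<n])" by (simp add: g_def)
  then obtain \<pi> where perm: "\<pi> permutes {..<n}"
    "permute_list \<pi> (map (\<lambda>k. arctan (l k)) [0..<n]) = g"
    by (elim mset_eq_permutation) simp
  have \<pi>: "g ! k = arctan (l (\<pi> k))" if "k < n" for k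
    using perm that permutes_in_image[OF perm(1), of k]
      permute_list_nth[of \<pi> "map (\<lambda>k. arctan (l k)) [0..<n]" k]
    by auto
  have g_sorted: "sorted_wrt (\<ge>) g" by (simp add: g_def sorted_wrt_rev)
  have g_range: "- (pi / 2) < x \<and> x < pi / 2" if "x \<in> set g" for x
    using that arctan_lbound arctan_ubound by (auto simp: g_def)
  \<comment> \<open>The number of full turns that brings the midpoint of the extreme phases into (-
    pi, pi]; rounding down makes the upper end the closed one.\<close>
  define N where "N = \<lfloor>(pi - (\<theta> + (hd g + last g) / 2)) / (2 * pi)\<rfloor>"
  define \<theta>' where "\<theta>' = \<theta> + 2 * pi * of_int N"
  have cis\<theta>': "cis \<theta>' = cis \<theta>"
    unfolding \<theta>'_def by (simp add: cis_mult[symmetric] cis_multiple_2pi)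
  define \<phi> where "\<phi> = map (\<lambda>x. \<theta>' + x) g"
  \<comment> \<open>The modulus of \<open>1 + \<i> * l k\<close> is
    \<open>sqrt (1 + (l k)\<^sup>2)\<close>. As \<open>T\<close> occurs twice in the congruence,
    each row takes the square root of this modulus.\<close>
  define T where "T = mat n n (\<lambda>(k, j). complex_of_real (sqrt (sqrt (1 + (l (\<pi> k))\<^sup>2))) * S $$ (\<pi> k, j))"
  have T: "T \<in> carrier_mat n n" by (simp add: T_def)
  have polar: "1 + \<i> * complex_of_real t = complex_of_real (sqrt (1 + t\<^sup>2)) * cis (arctan t)" for t
    by (simp add: complex_eq_iff cos_arctan sin_arctan add_nonneg_eq_0_iff)
  have AT: "A = mat_adjoint T * mat_diag n (\<lambda>k. cis (\<phi> ! k)) * T"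
  proof (rule eq_matI)
    fix i j assume "i < dim_row (mat_adjoint T * mat_diag n (\<lambda>k. cis (\<phi> ! k)) * T)"
      "j < dim_col (mat_adjoint T * mat_diag n (\<lambda>k. cis (\<phi> ! k)) * T)"
    then have ij: "i < n" "j < n" using T by auto
    have "A $$ (i, j) = cis \<theta> * B $$ (i, j)"
      using ij A by (simp add: B_def cis_mult flip: mult.assoc)
    also have "B $$ (i, j) = (\<Sum>k<n. cnj (S $$ (k, i)) * (1 + \<i> * complex_of_real (l k)) * S $$ (k, j))"
    proof -
      have "P $$ (i, j) = (\<Sum>k<n. cnj (S $$ (k, i)) * S $$ (k, j))"
        using ij S unfolding PS by (simp add: scalar_prod_def lessThan_atLeast0)
      moreover have "Q $$ (i, j) = (\<Sum>k<n. cnj (S $$ (k, i)) * complex_of_real (l k) * S $$ (k, j))"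
        using ij unfolding QS mat_diag_mult_mult[OF S] by simp
      ultimately show ?thesis
        unfolding BPQ[OF ij] by (simp add: sum_distrib_left algebra_simps sum.distrib)
    qed
    also have "\<dots> = (\<Sum>k<n. cnj (S $$ (\<pi> k, i)) * (1 + \<i> * complex_of_real (l (\<pi> k))) * S $$ (\<pi> k, j))"
      by (rule sum.reindex_bij_betw[OF permutes_imp_bij[OF perm(1)], symmetric])
    also have "cis \<theta> * \<dots> = (\<Sum>k<n. cnj (T $$ (k, i)) * cis (\<phi> ! k) * T $$ (k, j))"
      unfolding sum_distrib_left
    proof (intro sum.cong refl)
      fix k assume "k \<in> {..<n}"
      then have k: "k < n" by simp
      let ?r = "sqrt (sqrt (1 + (l (\<pi> k))\<^sup>2))"
      have "cis (\<phi> ! k) = cis \<theta> * cis (arctan (l (\<pi> k)))"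
        using k len \<pi> by (simp add: \<phi>_def cis\<theta>' flip: cis_mult)
      moreover have "complex_of_real (sqrt (1 + (l (\<pi> k))\<^sup>2)) = complex_of_real ?r * complex_of_real ?r"
        by (simp flip: of_real_mult)
      ultimately show "cis \<theta> * (cnj (S $$ (\<pi> k, i)) * (1 + \<i> * complex_of_real (l (\<pi> k))) * S $$ (\<pi> k, j)) =
        cnj (T $$ (k, i)) * cis (\<phi> ! k) * T $$ (k, j)"
        unfolding polar using k ij by (simp add: T_def mult_ac)
    qed
    finally show "A $$ (i, j) = (mat_adjoint T * mat_diag n (\<lambda>k. cis (\<phi> ! k)) * T) $$ (i, j)"
      using ij unfolding mat_diag_mult_mult[OF T] by simp
  qed (use A T in auto)
  \<comment> \<open>The form vanishes at no nonzero vector, so \<open>A\<close> is nonsingular, and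
    with it the factor \<open>T\<close>.\<close>
  have "det A \<noteq> 0"
  proof
    assume "det A = 0"
    then obtain v where "v \<in> carrier_vec n" "v \<noteq> 0\<^sub>v n" "A *\<^sub>v v = 0\<^sub>v n"
      using det_0_iff_vec_prod_zero[OF A] by auto
    with \<theta>[of v] show False by (simp add: quad_form_def)
  qed
  then have "det T \<noteq> 0" using T unfolding AT by (simp add: det_mult[of _ n])
  then have "invertible_mat T"
    using mat_inv_inverts[OF T] T unfolding invertible_mat_def inverts_mat_def by auto
  moreover have "sorted_wrt (\<ge>) \<phi>" using g_sorted by (simp add: \<phi>_def sorted_wrt_map)
  moreover have hl: "hd \<phi> = \<theta>' + hd g" "last \<phi> = \<theta>' + last g"
    using gne by (auto simp: \<phi>_def hd_map last_map)
  moreover have "hd \<phi> - last \<phi> < pi"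
    using g_range[of "hd g"] g_range[of "last g"] gne hl by simp
  moreover have "- pi < (hd \<phi> + last \<phi>) / 2 \<and> (hd \<phi> + last \<phi>) / 2 \<le> pi"
  proof -
    let ?m = "\<theta> + (hd g + last g) / 2"
    have "of_int N \<le> (pi - ?m) / (2 * pi)" "(pi - ?m) / (2 * pi) < of_int N + 1"
      unfolding N_def by linarith+
    then have "2 * pi * of_int N \<le> pi - ?m" "pi - ?m < 2 * pi * of_int N + 2 * pi"
      by (simp_all add: field_simps)
    moreover have "(hd \<phi> + last \<phi>) / 2 = ?m + 2 * pi * of_int N" unfolding hl \<theta>'_def by (simp add: field_simps)
    ultimately show ?thesis by linarith
  qed
  ultimately have "is_phases A \<phi>"
    using A T AT len unfolding is_phases_def by (auto simp: \<phi>_def intro!: bexI[of _ T])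
  then show ?thesis ..
qed

section \<open>Root homotopy\<close>

text \<open>All roots lie in the open left half-plane, so every linear factor has modulus at least
  \<open>Re s\<close>. For fixed degree the bound is a closed condition on the coefficients, through
  which stability passes to limits.\<close>

lemma stable_poly_lower_bound:
  fixes p :: "complex poly"
  assumes stable: "\<And>s. poly p s = 0 \<Longrightarrow> Re s < 0" and s: "Re s \<ge> 0"
  shows "cmod (lead_coeff p) * Re s ^ degree p \<le> cmod (poly p s)"
proof -
  obtain as where p: "smult (lead_coeff p) (\<Prod>a\<leftarrow>as. [:- a, 1:]) = p" and len: "length as = degree p"
    using fundamental_theorem_algebra_factorized[of p] by auto
  have poly_p: "poly p z = lead_coeff p * (\<Prod>a\<leftarrow>as. z - a)" for z
    by (subst p[symmetric]) (simp add: poly_prod_list o_def)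
  have as: "Re a < 0" if "a \<in> set as" for a
    using stable[of a] that poly_p[of a] by (auto simp: prod_list_zero_iff)
  have "Re s ^ length as \<le> (\<Prod>a\<leftarrow>as. cmod (s - a))"
    using as
  proof (induction as)
    case (Cons a as)
    have "Re s \<le> Re (s - a)" using Cons.prems[of a] by simp
    also have "\<dots> \<le> cmod (s - a)" by (rule complex_Re_le_cmod)
    finally show ?case using Cons s by (auto intro!: mult_mono)
  qed simp
  also have "\<dots> = cmod (\<Prod>a\<leftarrow>as. s - a)" by (induction as) (auto simp: norm_mult)
  finally show ?thesis unfolding poly_p norm_mult len by (simp add: mult_left_mono)
qed

text \<open>For \<open>cmod s > 1\<close> each lower power of \<open>s\<close> is bounded by the one
  just below the leading power, and the lower terms must balance the leading one. The bound varies
  continuously while the degree is constant.\<close>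

lemma poly_root_bound:
  fixes p :: "complex poly"
  assumes p: "p \<noteq> 0" and s: "poly p s = 0"
  shows "cmod s \<le> 1 + (\<Sum>k<degree p. cmod (coeff p k)) / cmod (lead_coeff p)"
proof (cases "cmod s \<le> 1")
  case True
  then show ?thesis by (smt (verit) divide_nonneg_nonneg norm_ge_zero sum_nonneg)
next
  case False
  define d where "d = degree p"
  have d: "d > 0" using p s by (metis d_def degree_eq_zeroE gr0I pCons_0_0 poly_const_conv)
  have "0 = (\<Sum>k<d. coeff p k * s ^ k) + lead_coeff p * s ^ d"
    using s unfolding poly_altdef d_def by (simp add: lessThan_Suc_atMost[symmetric])
  then have "lead_coeff p * s ^ d = - (\<Sum>k<d. coeff p k * s ^ k)"
    by (simp add: eq_neg_iff_add_eq_0 add.commute)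
  then have "cmod (lead_coeff p) * cmod s ^ d = cmod (\<Sum>k<d. coeff p k * s ^ k)"
    by (metis norm_minus_cancel norm_mult norm_power)
  also have "\<dots> \<le> (\<Sum>k<d. cmod (coeff p k) * cmod s ^ (d - 1))"
    using False d by (intro sum_norm_le) (auto simp: norm_mult norm_power intro!: mult_left_mono power_increasing)
  also have "\<dots> = (\<Sum>k<d. cmod (coeff p k)) * cmod s ^ (d - 1)" by (simp add: sum_distrib_right)
  finally have "cmod (lead_coeff p) * cmod s * cmod s ^ (d - 1) \<le> (\<Sum>k<d. cmod (coeff p k)) * cmod s ^ (d - 1)"
    using d by (simp add: power_eq_if mult_ac)
  then have "cmod (lead_coeff p) * cmod s \<le> (\<Sum>k<d. cmod (coeff p k))"
    using False by (simp add: mult_le_cancel_right not_le) (smt (verit) zero_less_power)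
  then have "cmod s \<le> (\<Sum>k<d. cmod (coeff p k)) / cmod (lead_coeff p)"
    using p by (simp add: field_simps)
  then show ?thesis by (simp add: d_def)
qed

text \<open>
  Roots cannot enter the closed right half-plane: they may neither cross the imaginary axis nor come
  from infinity, as the degree is constant.
\<close>

lemma hurwitz_homotopy:
  fixes p :: "real \<Rightarrow> complex poly"
  assumes cont: "\<And>k. continuous_on {0..1} (\<lambda>\<tau>. coeff (p \<tau>) k)"
    and deg: "\<And>\<tau>. \<tau> \<in> {0..1} \<Longrightarrow> degree (p \<tau>) = D"
    and ne: "\<And>\<tau>. \<tau> \<in> {0..1} \<Longrightarrow> p \<tau> \<noteq> 0"
    and axis: "\<And>\<tau> s. \<tau> \<in> {0..1} \<Longrightarrow> Re s = 0 \<Longrightarrow> poly (p \<tau>) s \<noteq> 0"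
    and base: "\<And>s. Re s \<ge> 0 \<Longrightarrow> poly (p 0) s \<noteq> 0"
    and s: "Re s \<ge> 0"
  shows "poly (p 1) s \<noteq> 0"
proof -
  define c where "c \<tau> k = coeff (p \<tau>) k" for \<tau> k
  have cD: "c \<tau> D \<noteq> 0" if "\<tau> \<in> {0..1}" for \<tau>
    using deg[OF that] ne[OF that] by (auto simp: c_def)
  note cont' = cont[folded c_def]
  define P where "P = (\<lambda>(\<tau>, s). \<Sum>k\<le>D. c \<tau> k * s ^ k)"
  have P: "P (\<tau>, s) = poly (p \<tau>) s" if "\<tau> \<in> {0..1}" for \<tau> s
    using deg[OF that] by (simp add: P_def c_def poly_altdef)
  have contP: "continuous_on ({0..1} \<times> B) P" for B
    unfolding P_def case_prod_unfold
    by (intro continuous_intros continuous_on_compose2[OF cont' continuous_on_fst[OF continuous_on_id]]) auto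
  \<comment> \<open>\<open>T\<close> and \<open>U\<close> are complementary in the interval. Once
    both are closed, connectedness leaves only \<open>U\<close>, which contains 0.\<close>
  define T where "T = {\<tau> \<in> {0..1}. \<exists>s. Re s \<ge> 0 \<and> poly (p \<tau>) s = 0}"
  define U where "U = {\<tau> \<in> {0..1}. \<forall>s. Re s \<ge> 0 \<longrightarrow> poly (p \<tau>) s \<noteq> 0}"
  have "closed T"
  proof -
    \<comment> \<open>\<open>f \<tau>\<close> bounds the roots of \<open>p \<tau>\<close> and is
      continuous because \<open>c \<tau> D\<close> does not vanish. A bound \<open>R\<close> on
      \<open>f\<close> confines the roots to one disc, so the pairs of a parameter and a root in the
      closed right half-plane form a compact set \<open>K\<close> with projection
      \<open>T\<close>.\<close>
    define f where "f \<tau> = 1 + (\<Sum>k<D. cmod (c \<tau> k)) / cmod (c \<tau> D)" for \<tau>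
    have "continuous_on {0..1} f"
      unfolding f_def using cD by (intro continuous_intros cont') auto
    then have "compact (f ` {0..1})" by (intro compact_continuous_image) auto
    then obtain R where R: "\<And>\<tau>. \<tau> \<in> {0..1} \<Longrightarrow> f \<tau> \<le> R"
      by (metis bounded_has_Sup(1) compact_imp_bounded empty_iff image_eqI)
    define K where "K = ({0..1} \<times> (cball 0 R \<inter> {s. Re s \<ge> 0})) \<inter> P -` {0}"
    have "compact (cball 0 R \<inter> {s. Re s \<ge> 0})"
      by (intro compact_Int_closed compact_cball closed_Collect_le continuous_intros)
    then have cp: "compact ({0..1 :: real} \<times> (cball 0 R \<inter> {s. Re s \<ge> 0}))"
      by (intro compact_Times) auto
    have "closed K" unfolding K_def
      by (intro continuous_closed_preimage contP compact_imp_closed cp) auto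
    then have "compact K"
      using compact_Int_closed[OF cp] by (metis K_def Int_absorb Int_commute Int_lower2 inf.absorb_iff2)
    then have "compact (fst ` K)" by (intro compact_continuous_image continuous_intros)
    also have "fst ` K = T"
    proof (intro equalityI subsetI)
      fix \<tau> assume "\<tau> \<in> fst ` K"
      then show "\<tau> \<in> T" using P by (fastforce simp: K_def T_def)
    next
      fix \<tau> assume "\<tau> \<in> T"
      then obtain s where s: "\<tau> \<in> {0..1}" "Re s \<ge> 0" "poly (p \<tau>) s = 0" by (auto simp: T_def)
      have "cmod s \<le> f \<tau>"
        using poly_root_bound[OF ne[OF s(1)] s(3)] by (simp add: f_def c_def deg[OF s(1)])
      also have "\<dots> \<le> R" by (rule R[OF s(1)])
      finally have "(\<tau>, s) \<in> K" using s P by (auto simp: K_def)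
      then show "\<tau> \<in> fst ` K" by (metis fst_conv image_eqI)
    qed
    finally show ?thesis by (rule compact_imp_closed)
  qed
  moreover have "closed U"
  proof -
    \<comment> \<open>Off the axis, stability amounts to the lower bound at every \<open>s\<close>
      with \<open>Re s > 0\<close>, each a closed condition on \<tau>; on the axis roots are
      excluded by \<open>axis\<close>.\<close>
    have "U = {0..1} \<inter> (\<Inter>s \<in> {s. Re s > 0}. {\<tau> \<in> {0..1}. cmod (c \<tau> D) * Re s ^ D \<le> cmod (P (\<tau>, s))})"
    proof (intro equalityI subsetI)
      fix \<tau> assume \<tau>: "\<tau> \<in> U"
      then have \<tau>1: "\<tau> \<in> {0..1}" by (simp add: U_def)
      have "poly (p \<tau>) s = 0 \<Longrightarrow> Re s < 0" for s using \<tau> by (force simp: U_def)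
      then have "cmod (c \<tau> D) * Re s ^ D \<le> cmod (poly (p \<tau>) s)" if "Re s > 0" for s
        using stable_poly_lower_bound[of "p \<tau>" s] that by (simp add: c_def deg[OF \<tau>1])
      then show "\<tau> \<in> {0..1} \<inter> (\<Inter>s \<in> {s. Re s > 0}. {\<tau> \<in> {0..1}. cmod (c \<tau> D) * Re s ^ D \<le> cmod (P (\<tau>, s))})"
        using \<tau>1 by (auto simp: P)
    next
      fix \<tau> assume \<tau>: "\<tau> \<in> {0..1} \<inter> (\<Inter>s \<in> {s. Re s > 0}. {\<tau> \<in> {0..1}. cmod (c \<tau> D) * Re s ^ D \<le> cmod (P (\<tau>, s))})"
      have "poly (p \<tau>) s \<noteq> 0" if "Re s \<ge> 0" for s
      proof (cases "Re s = 0")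
        case False
        then have s: "Re s > 0" using that by simp
        then have "0 < cmod (c \<tau> D) * Re s ^ D" using cD[of \<tau>] \<tau> by simp
        also have "\<dots> \<le> cmod (poly (p \<tau>) s)" using \<tau> s P by auto
        finally show ?thesis by auto
      qed (use axis \<tau> in auto)
      then show "\<tau> \<in> U" using \<tau> by (simp add: U_def)
    qed
    moreover have "closed {\<tau> \<in> {0..1}. cmod (c \<tau> D) * Re s ^ D \<le> cmod (P (\<tau>, s))}" for s
    proof (rule continuous_on_closed_Collect_le)
      show "continuous_on {0..1} (\<lambda>\<tau>. cmod (P (\<tau>, s)))"
        unfolding P_def by (simp, intro continuous_intros cont')
    qed (auto intro!: continuous_intros cont')
    ultimately show ?thesis by (auto intro!: closed_Int closed_INT)
  qed
  moreover have "connected {0..1 :: real}" by simp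
  moreover have "T \<inter> U = {}" "{0..1} \<subseteq> T \<union> U" by (auto simp: T_def U_def)
  moreover have "0 \<in> U" using base by (simp add: U_def)
  ultimately have "T \<inter> {0..1} = {}"
    unfolding connected_closed by (smt (verit) Int_iff U_def disjoint_iff mem_Collect_eq)
  then have "1 \<notin> T" by auto
  then show ?thesis using s by (auto simp: T_def)
qed

section \<open>Leading coefficients and continuity of polynomial determinants\<close>

lemma coeff_mult_top:
  assumes "degree p \<le> a" "degree q \<le> b"
  shows "coeff (p * q) (a + b) = coeff p a * coeff q b"
proof -
  have "coeff (p * q) (a + b) = (\<Sum>i\<le>a + b. coeff p i * coeff q (a + b - i))" by (rule coeff_mult)
  also have "\<dots> = (\<Sum>i\<le>a + b. if i = a then coeff p a * coeff q b else 0)"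
  proof (intro sum.cong refl)
    fix i assume "i \<in> {..a + b}"
    then show "coeff p i * coeff q (a + b - i) = (if i = a then coeff p a * coeff q b else 0)"
      using assms by (cases i a rule: linorder_cases) (auto simp: coeff_eq_0)
  qed
  finally show ?thesis by simp
qed

lemma degree_coeff_prod_top:
  assumes "finite I" "\<And>i. i \<in> I \<Longrightarrow> degree (f i) \<le> d"
  shows "degree (\<Prod>i\<in>I. f i) \<le> card I * d \<and> coeff (\<Prod>i\<in>I. f i) (card I * d) = (\<Prod>i\<in>I. coeff (f i) d)"
  using assms
proof (induction I)
  case (insert i I)
  then have d: "degree (f i) \<le> d" "degree (\<Prod>i\<in>I. f i) \<le> card I * d" by auto
  then have "degree (f i * (\<Prod>i\<in>I. f i)) \<le> d + card I * d"
    by (intro order_trans[OF degree_mult_le] add_mono)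
  with d show ?case using insert by (simp add: coeff_mult_top)
qed auto

text \<open>In each Leibniz product the coefficient at \<open>n * d\<close> is the product of the
  coefficients at \<open>d\<close>. This connects the leading coefficient of the determinant with
  the values at infinity.\<close>

lemma coeff_det_top:
  fixes M :: "'a :: comm_ring_1 poly mat"
  assumes M: "M \<in> carrier_mat n n" and deg: "\<And>i j. i < n \<Longrightarrow> j < n \<Longrightarrow> degree (M $$ (i, j)) \<le> d"
  shows "coeff (det M) (n * d) = det (map_mat (\<lambda>p. coeff p d) M)"
proof -
  have *: "coeff (\<Prod>i = 0..<n. M $$ (i, \<pi> i)) (n * d) = (\<Prod>i = 0..<n. coeff (M $$ (i, \<pi> i)) d)"
    if "\<pi> permutes {0..<n}" for \<pi>
    using degree_coeff_prod_top[of "{0..<n}" "\<lambda>i. M $$ (i, \<pi> i)" d] deg permutes_in_image[OF that]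
    by auto
  have "coeff (signof \<pi> * q) k = signof \<pi> * coeff q k" for \<pi> and q :: "'a poly" and k
    by (simp add: sign_def)
  then have "coeff (det M) (n * d) = (\<Sum>\<pi> | \<pi> permutes {0..<n}. signof \<pi> * (\<Prod>i = 0..<n. coeff (M $$ (i, \<pi> i)) d))"
    using M * by (auto simp: det_def' coeff_sum intro!: sum.cong)
  also have "\<dots> = det (map_mat (\<lambda>p. coeff p d) M)"
    using M permutes_in_image by (auto simp: det_def' intro!: sum.cong prod.cong)
  finally show ?thesis .
qed

lemma continuous_on_coeff_mult:
  fixes f g :: "'b :: topological_space \<Rightarrow> real poly"
  assumes "\<And>k. continuous_on S (\<lambda>t. coeff (f t) k)" "\<And>k. continuous_on S (\<lambda>t. coeff (g t) k)"
  shows "continuous_on S (\<lambda>t. coeff (f t * g t) k)"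
  unfolding coeff_mult by (intro continuous_intros assms)

lemma continuous_on_coeff_prod:
  fixes f :: "'i \<Rightarrow> 'b :: topological_space \<Rightarrow> real poly"
  assumes "finite I" "\<And>i k. i \<in> I \<Longrightarrow> continuous_on S (\<lambda>t. coeff (f i t) k)"
  shows "continuous_on S (\<lambda>t. coeff (\<Prod>i\<in>I. f i t) k)"
  using assms
  by (induction I arbitrary: k) (auto intro!: continuous_on_coeff_mult)

lemma continuous_on_coeff_det:
  fixes M :: "'b :: topological_space \<Rightarrow> real poly mat"
  assumes M: "\<And>t. M t \<in> carrier_mat n n"
    and cont: "\<And>i j k. i < n \<Longrightarrow> j < n \<Longrightarrow> continuous_on S (\<lambda>t. coeff (M t $$ (i, j)) k)"
  shows "continuous_on S (\<lambda>t. coeff (det (M t)) k)"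
proof -
  have "coeff (signof \<pi> * q) k = signof \<pi> * coeff q k" for \<pi> and q :: "real poly"
    by (simp add: sign_def)
  then have eq: "coeff (det (M t)) k =
    (\<Sum>\<pi> | \<pi> permutes {0..<n}. signof \<pi> * coeff (\<Prod>i = 0..<n. M t $$ (i, \<pi> i)) k)" for t
    by (simp add: det_def'[OF M] coeff_sum)
  have "continuous_on S (\<lambda>t. coeff (\<Prod>i = 0..<n. M t $$ (i, \<pi> i)) k)" if "\<pi> permutes {0..<n}" for \<pi>
    using permutes_in_image[OF that] by (intro continuous_on_coeff_prod cont) auto
  then show ?thesis unfolding eq by (intro continuous_intros) auto
qed

section \<open>Proper stable transfer functions\<close>

definition cpoly :: "real poly \<Rightarrow> complex \<Rightarrow> complex" where
  "cpoly p s = poly (map_poly complex_of_real p) s"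

text \<open>Evaluation thereby commutes with determinants of polynomial matrices.\<close>

lemma comm_ring_hom_cpoly: "comm_ring_hom (\<lambda>p. cpoly p s)"
proof -
  interpret h: map_poly_comm_ring_hom complex_of_real ..
  show ?thesis by unfold_locales (simp_all add: cpoly_def h.hom_add h.hom_mult)
qed

interpretation cpoly: comm_ring_hom "\<lambda>p. cpoly p s" for s
  by (rule comm_ring_hom_cpoly)

lemma cpoly_smult [simp]: "cpoly (smult c p) s = complex_of_real c * cpoly p s"
  by (simp add: cpoly_def map_poly_smult)

text \<open>Real coefficients make negative frequencies mirror images of positive ones.\<close>

lemma cpoly_cnj: "cpoly p (cnj s) = cnj (cpoly p s)"
  by (induction p) (simp_all add: cpoly_def map_poly_pCons)

definition hurwitz :: "real poly \<Rightarrow> bool" where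
  "hurwitz q \<longleftrightarrow> (\<forall>s. Re s \<ge> 0 \<longrightarrow> cpoly q s \<noteq> 0)"

lemma hurwitz_nonzero: "hurwitz q \<Longrightarrow> q \<noteq> 0"
  using cpoly.hom_zero[of 0] by (metis hurwitz_def order_refl zero_complex.sel(1))

lemma hurwitz_mult_iff: "hurwitz (p * q) \<longleftrightarrow> hurwitz p \<and> hurwitz q"
  by (auto simp: hurwitz_def cpoly.hom_mult)

lemma hurwitz_1 [simp]: "hurwitz 1"
  by (simp add: hurwitz_def)

text \<open>\<open>tf_num\<close> and \<open>tf_den\<close> form a coprime pair, so any other
  fraction for the same function arises by a common factor. This permits work with unreduced
  fractions.\<close>

lemma Fract_reduced:
  fixes a b :: "real poly"
  assumes "b \<noteq> 0"
  obtains e where "e \<noteq> 0" "a = tf_num (Fract a b) * e" "b = tf_den (Fract a b) * e"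
proof -
  define n d where "n = tf_num (Fract a b)" and "d = tf_den (Fract a b)"
  have d: "d \<noteq> 0" by (simp add: d_def tf_den_def)
  have "Fract n d = Fract a b" by (simp add: n_def d_def tf_num_def tf_den_def)
  then have eq: "n * b = a * d" using d assms by (simp add: eq_fract)
  have "coprime n d" unfolding n_def d_def tf_num_def tf_den_def by (rule coprime_quot_of_fract)
  moreover have "d dvd n * b" unfolding eq by simp
  ultimately have "d dvd b" by (simp add: coprime_commute coprime_dvd_mult_right_iff)
  then obtain e where e: "b = d * e" by auto
  have "n * e = a" using eq d unfolding e by (simp add: mult_ac)
  then have "a = n * e" by (rule sym)
  moreover have "e \<noteq> 0" using e assms by auto
  ultimately show thesis using that e unfolding n_def d_def by blast
qed

definition tf_RH :: "tf \<Rightarrow> bool" where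
  "tf_RH f \<longleftrightarrow> tf_proper f \<and> tf_stable f"

text \<open>The common factor by which the fraction differs from its reduced form divides
  \<open>b\<close>. So it has no root in the closed right half-plane and cancels in values, degrees
  and leading coefficients.\<close>

lemma tf_RH_Fract:
  assumes deg: "degree a \<le> degree b" and b: "hurwitz b"
  shows "tf_RH (Fract a b)"
    and "Re s \<ge> 0 \<Longrightarrow> tf_eval (Fract a b) s = cpoly a s / cpoly b s"
    and "tf_at_infinity (Fract a b) = complex_of_real (coeff a (degree b) / lead_coeff b)"
proof -
  obtain e where e: "e \<noteq> 0" and ab: "a = tf_num (Fract a b) * e" "b = tf_den (Fract a b) * e"
    using Fract_reduced[OF hurwitz_nonzero[OF b], of a] by metis
  let ?n = "tf_num (Fract a b)" and ?d = "tf_den (Fract a b)"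
  have d: "?d \<noteq> 0" by (simp add: tf_den_def)
  have degb: "degree b = degree ?d + degree e" by (subst ab(2)) (simp add: degree_mult_eq d e)
  have "degree a = degree ?n + degree e" if "?n \<noteq> 0" by (subst ab(1)) (simp add: degree_mult_eq that e)
  then have n: "degree ?n \<le> degree ?d" using deg degb by (cases "?n = 0") auto
  have "hurwitz (?d * e)" using b ab(2) by simp
  then have h: "hurwitz ?d" "hurwitz e" by (simp_all add: hurwitz_mult_iff)
  show "tf_RH (Fract a b)"
    using n h(1) by (simp add: tf_RH_def tf_proper_def tf_stable_def hurwitz_def cpoly_def)
  show "tf_eval (Fract a b) s = cpoly a s / cpoly b s" if s: "Re s \<ge> 0"
  proof -
    have "cpoly a s = cpoly ?n s * cpoly e s" by (subst ab(1)) (rule cpoly.hom_mult)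
    moreover have "cpoly b s = cpoly ?d s * cpoly e s" by (subst ab(2)) (rule cpoly.hom_mult)
    ultimately show ?thesis using h s by (simp add: tf_eval_def hurwitz_def flip: cpoly_def)
  qed
  have "coeff a (degree b) = coeff ?n (degree ?d) * lead_coeff e"
    unfolding degb by (subst ab(1)) (rule coeff_mult_top[OF n order_refl])
  moreover have "lead_coeff b = lead_coeff ?d * lead_coeff e" 
    using trans[OF arg_cong[OF ab(2), of lead_coeff] lead_coeff_mult] .
  ultimately show "tf_at_infinity (Fract a b) = complex_of_real (coeff a (degree b) / lead_coeff b)"
    using e by (simp add: tf_at_infinity_def)
qed

lemma tf_RH_E:
  assumes "tf_RH f"
  obtains a b where "f = Fract a b" "degree a \<le> degree b" "hurwitz b"
proof
  show "f = Fract (tf_num f) (tf_den f)" by (simp add: tf_num_def tf_den_def)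
  show "degree (tf_num f) \<le> degree (tf_den f)" using assms by (simp add: tf_RH_def tf_proper_def)
  show "hurwitz (tf_den f)" using assms by (simp add: tf_RH_def tf_stable_def hurwitz_def cpoly_def)
qed

text \<open>The product of the individual denominators serves: it stays Hurwitz, and extending a
  fraction preserves the degree inequality.\<close>

lemma tf_RH_common_denominator:
  assumes "finite F" "\<And>f. f \<in> F \<Longrightarrow> tf_RH f"
  obtains q where "hurwitz q" "\<And>f. f \<in> F \<Longrightarrow> \<exists>a. f = Fract a q \<and> degree a \<le> degree q"
  using assms
proof (induction F arbitrary: thesis)
  case empty
  then show ?case using hurwitz_1 by blast
next
  case (insert f F)
  obtain q where q: "hurwitz q" "\<And>f. f \<in> F \<Longrightarrow> \<exists>a. f = Fract a q \<and> degree a \<le> degree q"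
    using insert by (metis insertCI)
  obtain a b where f: "f = Fract a b" "degree a \<le> degree b" "hurwitz b"
    using tf_RH_E insert.prems(2) by (metis insertCI)
  have ne: "q \<noteq> 0" "b \<noteq> 0" using q f hurwitz_nonzero by auto
  have deg: "degree (q * b) = degree q + degree b" using ne by (rule degree_mult_eq)
  show ?case
  proof (rule insert.prems(1))
    show "hurwitz (q * b)" using q f by (simp add: hurwitz_mult_iff)
    fix g assume "g \<in> insert f F"
    then consider "g = f" | "g \<in> F" by auto
    then show "\<exists>a. g = Fract a (q * b) \<and> degree a \<le> degree (q * b)"
    proof cases
      case 1
      then have "g = Fract (q * a) (q * b)" using f ne by (simp add: eq_fract mult_ac)
      moreover have "degree (q * a) \<le> degree (q * b)"
        unfolding deg using degree_mult_le[of q a] f(2) by linarith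
      ultimately show ?thesis by blast
    next
      case 2
      then obtain c where c: "g = Fract c q" "degree c \<le> degree q" using q by blast
      then have "g = Fract (c * b) (q * b)" using ne by (simp add: eq_fract mult_ac)
      moreover have "degree (c * b) \<le> degree (q * b)"
        unfolding deg using degree_mult_le[of c b] c(2) by linarith
      ultimately show ?thesis by blast
    qed
  qed
qed

section \<open>The ring of proper stable functions and matrices over it\<close>

lemma tf_RH_const: "tf_RH (to_fract [:c:])"
  unfolding to_fract_def by (intro tf_RH_Fract) simp_all

lemma tf_RH_0 [simp]: "tf_RH 0" and tf_RH_1 [simp]: "tf_RH 1"
  using tf_RH_const[of 0] tf_RH_const[of 1] by (simp_all add: pCons_one)

lemma tf_RH_add: "tf_RH f \<Longrightarrow> tf_RH g \<Longrightarrow> tf_RH (f + g)"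
proof (elim tf_RH_E)
  fix a b c d assume fg: "f = Fract a b" "degree a \<le> degree b" "hurwitz b" "g = Fract c d" "degree c \<le> degree d" "hurwitz d"
  have ne: "b \<noteq> 0" "d \<noteq> 0" using fg hurwitz_nonzero by auto
  have "degree (a * d + c * b) \<le> degree (b * d)"
    using degree_mult_le[of a d] degree_mult_le[of c b] degree_mult_eq[OF ne] fg(2,5)
    by (intro degree_add_le) linarith+
  moreover have "hurwitz (b * d)" using fg(3,6) by (simp add: hurwitz_mult_iff)
  ultimately have "tf_RH (Fract (a * d + c * b) (b * d))" by (rule tf_RH_Fract(1))
  then show "tf_RH (f + g)" unfolding fg(1,4) using ne by simp
qed

lemma tf_RH_mult: "tf_RH f \<Longrightarrow> tf_RH g \<Longrightarrow> tf_RH (f * g)"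
proof (elim tf_RH_E)
  fix a b c d assume fg: "f = Fract a b" "degree a \<le> degree b" "hurwitz b" "g = Fract c d" "degree c \<le> degree d" "hurwitz d"
  have ne: "b \<noteq> 0" "d \<noteq> 0" using fg hurwitz_nonzero by auto
  have "degree (a * c) \<le> degree (b * d)"
    using degree_mult_le[of a c] degree_mult_eq[OF ne] fg(2,5) by linarith
  moreover have "hurwitz (b * d)" using fg(3,6) by (simp add: hurwitz_mult_iff)
  ultimately have "tf_RH (Fract (a * c) (b * d))" by (rule tf_RH_Fract(1))
  then show "tf_RH (f * g)" unfolding fg(1,4) by simp
qed

lemma tf_RH_uminus: "tf_RH f \<Longrightarrow> tf_RH (- f)"
proof -
  have "to_fract [:- 1:] = (- 1 :: tf)" by (simp add: to_fract_def One_fract_def one_pCons)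
  then show "tf_RH f \<Longrightarrow> tf_RH (- f)" using tf_RH_mult[OF tf_RH_const[of "- 1"], of f] by simp
qed

lemma tf_RH_sum: "(\<And>i. i \<in> I \<Longrightarrow> tf_RH (f i)) \<Longrightarrow> tf_RH (\<Sum>i\<in>I. f i)"
  by (induction I rule: infinite_finite_induct) (auto intro: tf_RH_add)

lemma tf_RH_prod: "(\<And>i. i \<in> I \<Longrightarrow> tf_RH (f i)) \<Longrightarrow> tf_RH (\<Prod>i\<in>I. f i)"
  by (induction I rule: infinite_finite_induct) (auto intro: tf_RH_mult)

lemma RH_inf_iff: "F \<in> RH_inf m n \<longleftrightarrow> F \<in> carrier_mat m n \<and> (\<forall>i<m. \<forall>j<n. tf_RH (F $$ (i, j)))"
  by (simp add: RH_inf_def tf_RH_def)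

lemma RH_inf_mult: "F \<in> RH_inf m n \<Longrightarrow> K \<in> RH_inf n k \<Longrightarrow> F * K \<in> RH_inf m k"
  unfolding RH_inf_iff
proof (intro conjI allI impI; (elim conjE)?)
  fix i j assume F: "F \<in> carrier_mat m n" "\<forall>i<m. \<forall>j<n. tf_RH (F $$ (i, j))"
    and K: "K \<in> carrier_mat n k" "\<forall>i<n. \<forall>j<k. tf_RH (K $$ (i, j))" and ij: "i < m" "j < k"
  have "(F * K) $$ (i, j) = (\<Sum>l = 0..<n. F $$ (i, l) * K $$ (l, j))"
    using F(1) K(1) ij by (simp add: scalar_prod_def)
  also have "tf_RH \<dots>" using F(2) K(2) ij by (intro tf_RH_sum tf_RH_mult) auto
  finally show "tf_RH ((F * K) $$ (i, j))" .
qed simp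

lemma tf_RH_det:
  assumes "F \<in> RH_inf n n"
  shows "tf_RH (det F)"
proof -
  have F: "F \<in> carrier_mat n n" "\<And>i j. i < n \<Longrightarrow> j < n \<Longrightarrow> tf_RH (F $$ (i, j))"
    using assms by (auto simp: RH_inf_iff)
  have "tf_RH (signof \<pi> * (\<Prod>i = 0..<n. F $$ (i, \<pi> i)))" if "\<pi> permutes {0..<n}" for \<pi>
  proof -
    have "tf_RH (\<Prod>i = 0..<n. F $$ (i, \<pi> i))"
      using permutes_in_image[OF that] by (intro tf_RH_prod F) auto
    then show ?thesis by (auto simp: sign_def intro: tf_RH_uminus)
  qed
  then show ?thesis unfolding det_def'[OF F(1)] by (intro tf_RH_sum) auto
qed

lemma RH_inf_adj_mat:
  assumes F: "F \<in> RH_inf n n"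
  shows "adj_mat F \<in> RH_inf n n"
proof -
  have Fc: "F \<in> carrier_mat n n" using F by (simp add: RH_inf_iff)
  have "tf_RH (cofactor F j i)" if ij: "i < n" "j < n" for i j
  proof -
    have "mat_delete F j i \<in> RH_inf (n - 1) (n - 1)"
      using F ij unfolding RH_inf_iff by (auto simp: mat_delete_def)
    then have "tf_RH (det (mat_delete F j i))" by (rule tf_RH_det)
    moreover have "(- 1) ^ k = (1 :: tf) \<or> (- 1) ^ k = (- 1 :: tf)" for k
      by (cases "even k") auto
    then have "cofactor F j i = det (mat_delete F j i) \<or> cofactor F j i = - det (mat_delete F j i)"
      unfolding cofactor_def by (metis mult_1 mult_minus1)
    ultimately show ?thesis using tf_RH_uminus by metis
  qed
  then show ?thesis using adj_mat(1)[OF Fc] Fc unfolding RH_inf_iff adj_mat_def by auto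
qed

text \<open>Cramer's rule: the inverse is \<open>inverse (det F)\<close> times the adjugate, whose
  entries are, up to sign, determinants over the ring.\<close>

lemma RH_inf_mat_inv:
  assumes F: "F \<in> RH_inf n n" and d: "det F \<noteq> 0" "tf_RH (inverse (det F))"
  shows "mat_inv F \<in> RH_inf n n"
proof -
  have Fc: "F \<in> carrier_mat n n" using F by (simp add: RH_inf_iff)
  note I = mat_inv_inverts[OF Fc d(1)]
  have adj: "adj_mat F \<in> carrier_mat n n" by (rule adj_mat(1)[OF Fc])
  have "inverse (det F) \<cdot>\<^sub>m (det F \<cdot>\<^sub>m 1\<^sub>m n) = 1\<^sub>m n" using d(1) by (intro eq_matI) auto
  then have "mat_inv F = mat_inv F * (inverse (det F) \<cdot>\<^sub>m (F * adj_mat F))"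
    unfolding adj_mat(2)[OF Fc] using I(1) by simp
  also have "\<dots> = inverse (det F) \<cdot>\<^sub>m (mat_inv F * (F * adj_mat F))"
    by (rule mult_smult_distrib[of _ n n _ n]) (use I(1) Fc adj in auto)
  also have "mat_inv F * (F * adj_mat F) = (mat_inv F * F) * adj_mat F"
    by (rule assoc_mult_mat[OF I(1) Fc adj, symmetric])
  also have "\<dots> = adj_mat F" unfolding I(3) using adj by simp
  finally show ?thesis
    using RH_inf_adj_mat[OF F] d(2) by (auto simp: RH_inf_iff intro!: tf_RH_mult)
qed

section \<open>The feedback interconnection\<close>

text \<open>Serves to clear denominators: \<open>c\<close> will be the common denominator evaluated
  at a point, its leading coefficient, or the denominator itself as a rational function.\<close>

lemma det_smult_one_add:
  fixes A :: "'a :: comm_ring_1 mat"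
  assumes "A \<in> carrier_mat m m" "M \<in> carrier_mat m m"
    and "\<And>i j. i < m \<Longrightarrow> j < m \<Longrightarrow> M $$ (i, j) = c * A $$ (i, j)"
  shows "det M = c ^ m * det A"
proof -
  have "M = c \<cdot>\<^sub>m A" using assms by (intro eq_matI) auto
  then show ?thesis using assms(1) by simp
qed

lemma RH_inf_four_block:
  assumes "A \<in> RH_inf m m" "B \<in> RH_inf m m" "C \<in> RH_inf m m" "D \<in> RH_inf m m"
  shows "four_block_mat A B C D \<in> RH_inf (m + m) (m + m)"
proof -
  have c: "A \<in> carrier_mat m m" "D \<in> carrier_mat m m" using assms by (auto simp: RH_inf_iff)
  have "tf_RH (four_block_mat A B C D $$ (i, j))" if "i < m + m" "j < m + m" for i j
    using that c assms by (auto simp: RH_inf_iff)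
  then show ?thesis using c by (auto simp: RH_inf_iff)
qed

text \<open>Over a common Hurwitz denominator \<open>q\<close> of the entries of \<open>G\<close>,
  \<open>q ^ m\<close> times the determinant of \<open>I + \<tau> H G\<close> is a polynomial
  \<open>p \<tau>\<close>. Finite frequencies exclude imaginary roots, infinity fixes the degree,
  and at \<tau> = 0 the polynomial is Hurwitz; by homotopy so is \<open>p 1\<close>, which makes the
  determinant at \<tau> = 1 a unit of the ring.\<close>

lemma feedback_stable_of_det:
  fixes G :: tf_mat and H :: "real mat"
  assumes G: "G \<in> RH_inf m m" and H: "H \<in> carrier_mat m m"
    and finite_freq: "\<And>\<omega> \<tau>. 0 \<le> \<omega> \<Longrightarrow> 0 \<le> \<tau> \<Longrightarrow> \<tau> \<le> 1 \<Longrightarrow>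
      det (1\<^sub>m m + complex_of_real \<tau> \<cdot>\<^sub>m (map_mat complex_of_real H * freq_response G \<omega>)) \<noteq> 0"
    and infinite_freq: "\<And>\<tau>. 0 \<le> \<tau> \<Longrightarrow> \<tau> \<le> 1 \<Longrightarrow>
      det (1\<^sub>m m + complex_of_real \<tau> \<cdot>\<^sub>m (map_mat complex_of_real H * freq_response_infinity G)) \<noteq> 0"
  shows "feedback_stable m G (const_tf_mat H)"
proof -
  let ?Hc = "map_mat complex_of_real H"
  have Gc: "G \<in> carrier_mat m m" using G by (simp add: RH_inf_iff)
  have Hc: "?Hc \<in> carrier_mat m m" using H by simp
  define F where "F = (\<lambda>(i, j). G $$ (i, j)) ` ({..<m} \<times> {..<m})"
  have "finite F" "\<And>f. f \<in> F \<Longrightarrow> tf_RH f" using G by (auto simp: F_def RH_inf_iff)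
  then obtain q where q: "hurwitz q" "\<And>f. f \<in> F \<Longrightarrow> \<exists>a. f = Fract a q \<and> degree a \<le> degree q"
    using tf_RH_common_denominator by metis
  have "\<forall>i j. \<exists>a. i < m \<longrightarrow> j < m \<longrightarrow> G $$ (i, j) = Fract a q \<and> degree a \<le> degree q"
    using q(2) by (fastforce simp: F_def)
  then obtain N where N: "\<And>i j. i < m \<Longrightarrow> j < m \<Longrightarrow> G $$ (i, j) = Fract (N i j) q"
    "\<And>i j. i < m \<Longrightarrow> j < m \<Longrightarrow> degree (N i j) \<le> degree q"
    by metis
  have q0: "q \<noteq> 0" by (rule hurwitz_nonzero[OF q(1)])
  define d where "d = degree q"
  \<comment> \<open>\<open>q\<close> times \<open>I + \<tau> H G\<close>, cleared of denominators
    entry by entry.\<close>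
  define M where "M \<tau> = mat m m (\<lambda>(i, j). (if i = j then q else 0) +
    smult \<tau> (\<Sum>k = 0..<m. smult (H $$ (i, k)) (N k j)))" for \<tau>
  have M: "M \<tau> \<in> carrier_mat m m" for \<tau> by (simp add: M_def)
  have Mdeg: "degree (M \<tau> $$ (i, j)) \<le> d" if "i < m" "j < m" for \<tau> i j
    using that N(2) unfolding M_def d_def
    by (auto intro!: degree_add_le degree_sum_le order_trans[OF degree_smult_le])
  define p where "p \<tau> = det (M \<tau>)" for \<tau>
  have eval: "cpoly (p \<tau>) s = cpoly q s ^ m * det (1\<^sub>m m + complex_of_real \<tau> \<cdot>\<^sub>m (?Hc * map_mat (\<lambda>f. tf_eval f s) G))"
    if s: "Re s \<ge> 0" for \<tau> s
  proof -
    have qs: "cpoly q s \<noteq> 0" using q(1) s by (simp add: hurwitz_def)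
    have "cpoly (p \<tau>) s = det (map_mat (\<lambda>f. cpoly f s) (M \<tau>))" unfolding p_def by simp
    also have "\<dots> = cpoly q s ^ m * det (1\<^sub>m m + complex_of_real \<tau> \<cdot>\<^sub>m (?Hc * map_mat (\<lambda>f. tf_eval f s) G))"
    proof (rule det_smult_one_add)
      fix i j assume ij: "i < m" "j < m"
      have "tf_eval (G $$ (k, j)) s = cpoly (N k j) s / cpoly q s" if "k < m" for k
        using N[OF that ij(2)] tf_RH_Fract(2)[OF _ q(1) s] by simp
      then show "map_mat (\<lambda>f. cpoly f s) (M \<tau>) $$ (i, j) =
        cpoly q s * (1\<^sub>m m + complex_of_real \<tau> \<cdot>\<^sub>m (?Hc * map_mat (\<lambda>f. tf_eval f s) G)) $$ (i, j)"
        using ij qs H Gc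
        by (simp add: M_def cpoly.hom_add cpoly.hom_sum scalar_prod_def sum_distrib_left distrib_left mult.left_commute)
    qed (use M Hc Gc in auto)
    finally show ?thesis .
  qed
  \<comment> \<open>Nonsingularity at infinity thus prevents the degree of \<open>p \<tau>\<close>
    from dropping below \<open>m * d\<close>.\<close>
  have lead: "complex_of_real (coeff (p \<tau>) (m * d)) =
    complex_of_real (lead_coeff q) ^ m * det (1\<^sub>m m + complex_of_real \<tau> \<cdot>\<^sub>m (?Hc * freq_response_infinity G))" for \<tau>
  proof -
    have "complex_of_real (coeff (p \<tau>) (m * d)) = det (map_mat complex_of_real (map_mat (\<lambda>f. coeff f d) (M \<tau>)))"
      unfolding p_def using coeff_det_top[OF M[of \<tau>] Mdeg] by simp
    also have "\<dots> = complex_of_real (lead_coeff q) ^ m * det (1\<^sub>m m + complex_of_real \<tau> \<cdot>\<^sub>m (?Hc * freq_response_infinity G))"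
    proof (rule det_smult_one_add)
      fix i j assume ij: "i < m" "j < m"
      have "tf_at_infinity (G $$ (k, j)) = complex_of_real (coeff (N k j) d) / complex_of_real (lead_coeff q)" if "k < m" for k
        using N[OF that ij(2)] tf_RH_Fract(3)[OF _ q(1)] by (simp add: d_def)
      then show "map_mat complex_of_real (map_mat (\<lambda>f. coeff f d) (M \<tau>)) $$ (i, j) =
        complex_of_real (lead_coeff q) * (1\<^sub>m m + complex_of_real \<tau> \<cdot>\<^sub>m (?Hc * freq_response_infinity G)) $$ (i, j)"
        using ij q0 H Gc
        by (simp add: M_def freq_response_infinity_def coeff_sum scalar_prod_def sum_distrib_left distrib_left
            mult.left_commute d_def)
    qed (use M Hc Gc in \<open>auto simp: freq_response_infinity_def\<close>)
    finally show ?thesis .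
  qed
  have pdeg: "degree (p \<tau>) = m * d" "p \<tau> \<noteq> 0" if "\<tau> \<in> {0..1}" for \<tau>
  proof -
    have "degree (p \<tau>) \<le> d * m" unfolding p_def by (rule degree_det_le[OF Mdeg M])
    moreover have "complex_of_real (coeff (p \<tau>) (m * d)) \<noteq> 0"
      unfolding lead using infinite_freq[of \<tau>] that q0 by simp
    ultimately show "degree (p \<tau>) = m * d" "p \<tau> \<noteq> 0"
      using le_degree[of "p \<tau>" "m * d"] by (auto simp: mult.commute)
  qed
  have one: "det (1\<^sub>m m + complex_of_real 0 \<cdot>\<^sub>m (?Hc * map_mat (\<lambda>f. tf_eval f s) G)) = 1" for s
  proof -
    have "1\<^sub>m m + complex_of_real 0 \<cdot>\<^sub>m (?Hc * map_mat (\<lambda>f. tf_eval f s) G) = 1\<^sub>m m"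
      using Hc Gc by (intro eq_matI) auto
    then show ?thesis by simp
  qed
  have "cpoly (p 1) s \<noteq> 0" if "Re s \<ge> 0" for s
    unfolding cpoly_def
  proof (rule hurwitz_homotopy[where p = "\<lambda>\<tau>. map_poly complex_of_real (p \<tau>)" and D = "m * d"])
    have "continuous_on {0..1} (\<lambda>\<tau>. coeff (p \<tau>) k)" for k
      unfolding p_def by (intro continuous_on_coeff_det[OF M])
        (auto simp: M_def intro!: continuous_intros)
    then show "continuous_on {0..1} (\<lambda>\<tau>. coeff (map_poly complex_of_real (p \<tau>)) k)" for k
      by (simp add: coeff_map_poly continuous_on_of_real)
    show "degree (map_poly complex_of_real (p \<tau>)) = m * d" if "\<tau> \<in> {0..1}" for \<tau>
      using pdeg[OF that] by (simp add: degree_map_poly)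
    show "map_poly complex_of_real (p \<tau>) \<noteq> 0" if "\<tau> \<in> {0..1}" for \<tau>
      using pdeg[OF that] by (simp add: map_poly_eq_0_iff)
    show "poly (map_poly complex_of_real (p \<tau>)) s \<noteq> 0" if \<tau>: "\<tau> \<in> {0..1}" and s: "Re s = 0" for \<tau> s
    proof -
      have *: "cpoly (p \<tau>) (\<i> * complex_of_real \<omega>) \<noteq> 0" if "\<omega> \<ge> 0" for \<omega>
        using finite_freq[OF that, of \<tau>] \<tau> q(1) unfolding freq_response_def
        by (subst eval) (auto simp: hurwitz_def)
      \<comment> \<open>Only nonnegative frequencies are covered by the hypothesis; a point on the
        lower half of the axis is replaced by its conjugate.\<close>
      have "s = \<i> * complex_of_real (Im s)" "cnj s = \<i> * complex_of_real (- Im s)"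
        using s by (auto simp: complex_eq_iff)
      then have "cpoly (p \<tau>) s \<noteq> 0 \<or> cpoly (p \<tau>) (cnj s) \<noteq> 0"
        using *[of "Im s"] *[of "- Im s"] by (cases "Im s \<ge> 0") auto
      then show ?thesis by (auto simp: cpoly_cnj simp flip: cpoly_def)
    qed
    show "poly (map_poly complex_of_real (p 0)) s \<noteq> 0" if "Re s \<ge> 0" for s
      using q(1) that unfolding cpoly_def[symmetric] eval[OF that] one by (simp add: hurwitz_def)
  qed (use that in simp)
  then have hp: "hurwitz (p 1)" by (simp add: hurwitz_def)
  let ?H = "const_tf_mat H"
  have HR: "?H \<in> RH_inf m m" using H by (auto simp: RH_inf_iff const_tf_mat_def tf_RH_const)
  define L where "L = 1\<^sub>m m + ?H * G"
  have HG: "?H * G \<in> RH_inf m m" by (rule RH_inf_mult[OF HR G])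
  have "1\<^sub>m m + X \<in> RH_inf m m" if "X \<in> RH_inf m m" for X
    using that unfolding RH_inf_iff by (auto intro!: tf_RH_add)
  from this[OF HG] have L: "L \<in> RH_inf m m" unfolding L_def .
  then have Lc: "L \<in> carrier_mat m m" by (simp add: RH_inf_iff)
  \<comment> \<open>The same identity, now over the field of rational functions, ties
    \<open>p 1\<close> to the determinant of \<open>I + H G\<close>.\<close>
  have "to_fract (p 1) = to_fract q ^ m * det L"
  proof -
    have "to_fract (p 1) = det (map_mat to_fract (M 1))"
      unfolding p_def by (rule comm_ring_hom.hom_det[symmetric]) (unfold_locales, simp_all)
    also have "\<dots> = to_fract q ^ m * det L"
    proof (rule det_smult_one_add)
      fix i j assume ij: "i < m" "j < m"
      have Nk: "to_fract q * G $$ (k, j) = to_fract (N k j)" if "k < m" for k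
        unfolding N(1)[OF that ij(2)] to_fract_def using q0 by (simp add: eq_fract)
      have sm: "to_fract (smult c f) = to_fract [:c:] * to_fract f" for c and f :: "real poly"
        by (simp flip: to_fract_mult)
      have sumf: "to_fract (\<Sum>k = 0..<m. f k) = (\<Sum>k = 0..<m. to_fract (f k))" for f :: "nat \<Rightarrow> real poly"
        by (induction m) auto
      have "to_fract q * L $$ (i, j) = (if i = j then to_fract q else 0) +
        (\<Sum>k = 0..<m. to_fract [:H $$ (i, k):] * (to_fract q * G $$ (k, j)))"
        using ij H Gc by (simp add: L_def const_tf_mat_def scalar_prod_def distrib_left sum_distrib_left mult.left_commute)
      also have "\<dots> = map_mat to_fract (M 1) $$ (i, j)"
        using ij Nk by (simp add: M_def sm sumf)
      finally show "map_mat to_fract (M 1) $$ (i, j) = to_fract q * L $$ (i, j)" ..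
    qed (use M Lc in auto)
    finally show ?thesis .
  qed
  moreover have "to_fract q ^ m = to_fract (q ^ m)" by (induction m) auto
  ultimately have detL: "det L = Fract (p 1) (q ^ m)"
    using q0 by (simp add: Fract_conv_to_fract field_simps)
  have p0: "p 1 \<noteq> 0" by (rule hurwitz_nonzero[OF hp])
  then have dL: "det L \<noteq> 0" using q0 unfolding detL by (simp add: Fract_conv_to_fract)
  \<comment> \<open>Both degrees equal \<open>m * d\<close>, so the inverse of the determinant,
    \<open>q ^ m\<close> over \<open>p 1\<close>, is proper; it is stable because \<open>p 1\<close>
    is Hurwitz.\<close>
  have "degree (q ^ m) \<le> degree (p 1)"
    using pdeg(1)[of 1] q0 by (simp add: degree_power_eq d_def)
  then have "tf_RH (inverse (det L))"
    using tf_RH_Fract(1)[OF _ hp] unfolding detL by simp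
  then have S: "mat_inv L \<in> RH_inf m m" by (rule RH_inf_mat_inv[OF L dL])
  have "invertible_mat L"
    using mat_inv_inverts[OF Lc dL] Lc unfolding invertible_mat_def inverts_mat_def by auto
  moreover have "feedback G ?H \<in> RH_inf (2 * m) (2 * m)"
  proof -
    have Gm: "dim_row G = m" using Gc by simp
    let ?S = "mat_inv L"
    note parts = S RH_inf_mult[OF S HR] RH_inf_mult[OF G S] RH_inf_mult[OF RH_inf_mult[OF G S] HR]
    have "feedback G ?H = four_block_mat ?S (?S * ?H) (G * ?S) (G * ?S * ?H)"
      by (simp add: feedback_def Let_def Gm L_def)
    then show ?thesis using RH_inf_four_block[OF parts] by (simp add: mult_2)
  qed
  ultimately show ?thesis by (simp add: feedback_stable_def L_def)
qed

text \<open>With \<open>f 0 = 0\<close> the off-diagonal blocks stay zero, so a frequency response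
  is formed block by block.\<close>

lemma map_mat_diag_block_mat:
  assumes "f 0 = 0"
  shows "map_mat f (diag_block_mat As) = diag_block_mat (map (map_mat f) As)"
proof (induction As)
  case (Cons A As)
  have "map_mat f (diag_block_mat (A # As)) =
    four_block_mat (map_mat f A) (0\<^sub>m (dim_row A) (dim_col (diag_block_mat As)))
      (0\<^sub>m (dim_row (diag_block_mat As)) (dim_col A)) (map_mat f (diag_block_mat As))"
    using assms by (intro eq_matI) (auto simp: Let_def)
  then show ?case unfolding Cons by (simp add: Let_def dim_diag_block_mat o_def)
qed (auto simp: assms)

text \<open>Whichever condition holds, it supplies a separating form for each \<tau> > 0; the forms
  for different \<tau> need not coincide.\<close>

lemma conditions_det_nonzero:
  fixes H :: "real mat"
  assumes As: "As \<noteq> []" "\<forall>A \<in> set As. square_mat A \<and> dim_row A > 0"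
    and m: "m = sum_list (map dim_row As)"
    and H: "H \<in> carrier_mat m m" "positive_definite H"
    and cond: "gain_condition As (map_mat complex_of_real H) \<or> phase_condition As
      \<or> xz_condition As (map_mat complex_of_real H)"
    and \<tau>: "0 \<le> \<tau>" "\<tau> \<le> 1"
  shows "det (1\<^sub>m m + complex_of_real \<tau> \<cdot>\<^sub>m (map_mat complex_of_real H * diag_block_mat As)) \<noteq> 0"
proof -
  let ?H = "map_mat complex_of_real H"
  note K = positive_definite_mat_inv[OF H]
  have Hc: "?H \<in> carrier_mat m m" using H by simp
  \<comment> \<open>Positive size guarantees that \<open>mat_inv ?H\<close> has extreme singular
    values and eigenvalues.\<close>
  have "m > 0"
  proof -
    obtain A where "A \<in> set As" using As(1) by (cases As) auto
    then have "dim_row A \<le> m" unfolding m by (intro member_le_sum_list) auto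
    then show ?thesis using As(2) \<open>A \<in> set As\<close> by auto
  qed
  have Kquad: "Re (quad_form (mat_inv ?H) x) \<ge> 0 \<and> Im (quad_form (mat_inv ?H) x) = 0"
    if x: "x \<in> carrier_vec m" for x
  proof -
    obtain U and l :: "nat \<Rightarrow> real" where U: "U \<in> carrier_mat m m" "mat_adjoint U * U = 1\<^sub>m m"
      and KU: "mat_inv ?H = U * mat_diag m (\<lambda>k. complex_of_real (l k)) * mat_adjoint U"
      using hermitian_spectral[OF K(1,3)] by metis
    have "Im (quad_form (mat_inv ?H) x) = 0" unfolding unitary_spectral_forms(1)[OF U KU x] by simp
    moreover have "Re (quad_form (mat_inv ?H) x) \<ge> 0"
      using K(4)[OF x] K(1) by (cases "x = 0\<^sub>v m") (auto simp: quad_form_def)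
    ultimately show ?thesis by simp
  qed
  show ?thesis
  proof (rule quad_multiplier_det_nonzero[OF _ m Hc K(1,2) \<tau>(1)])
    show "\<forall>A \<in> set As. square_mat A" using As by auto
    assume pos: "0 < \<tau>"
    from cond show "\<exists>a b c.
      (\<forall>A \<in> set As. \<forall>y \<in> carrier_vec (dim_row A). y \<noteq> 0\<^sub>v (dim_row A) \<longrightarrow> 0 < quad_multiplier a b c A y) \<and>
      (\<forall>x \<in> carrier_vec m. quad_multiplier a b c (complex_of_real (- (1 / \<tau>)) \<cdot>\<^sub>m mat_inv ?H) x \<le> 0)"
    proof (elim disjE)
      assume "gain_condition As ?H"
      then show ?thesis by (rule gain_multiplier[OF As(2) K(1) \<open>m > 0\<close> pos \<tau>(2)])
    next
      assume ph: "phase_condition As"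
      \<comment> \<open>Sectoriality guarantees that a phase list exists, so the choice in
        \<open>phases\<close> picks a genuine one.\<close>
      have "is_phases A (phases A)" if "A \<in> set As" for A
      proof -
        have "A \<in> carrier_mat (dim_row A) (dim_row A)" "dim_row A > 0" "sectorial A"
          using As(2) ph that by (auto simp: phase_condition_def intro!: carrier_matI)
        then have "\<exists>\<phi>. is_phases A \<phi>" by (rule sectorial_is_phases)
        then show ?thesis unfolding phases_def by (rule someI_ex)
      qed
      then show ?thesis using phase_multiplier[OF As(2,1) _ K(1) Kquad pos ph] by blast
    next
      assume "xz_condition As ?H"
      then show ?thesis using xz_multiplier[OF As(2) K(1,3) \<open>m > 0\<close> _ pos \<tau>(2)] K(4) by blast
    qed
  qed
qed

theorem theorem4p7:
  fixes G :: "real poly fract mat" and Gs :: "real poly fract mat list"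
    and H :: "real mat" and m :: nat
  assumes G: "G \<in> RH_inf m m"
    and blocks: "G = diag_block_mat Gs" "Gs \<noteq> []"
      "\<forall>A \<in> set Gs. square_mat A \<and> dim_row A > 0"
    and H: "H \<in> carrier_mat m m" "positive_definite H"
    and finite_freq: "\<forall>\<omega>::real. \<omega> \<ge> 0 \<longrightarrow>
        gain_condition (map (\<lambda>A. freq_response A \<omega>) Gs) (map_mat complex_of_real H)
      \<or> phase_condition (map (\<lambda>A. freq_response A \<omega>) Gs)
      \<or> xz_condition (map (\<lambda>A. freq_response A \<omega>) Gs) (map_mat complex_of_real H)"
    and infinite_freq:
        "gain_condition (map freq_response_infinity Gs) (map_mat complex_of_real H)
      \<or> phase_condition (map freq_response_infinity Gs)
      \<or> xz_condition (map freq_response_infinity Gs) (map_mat complex_of_real H)"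
  shows "feedback_stable m G (const_tf_mat H)"
proof (rule feedback_stable_of_det[OF G H(1)])
  have m: "m = sum_list (map dim_row Gs)"
    using G by (auto simp: RH_inf_def blocks(1) dim_diag_block_mat)
  \<comment> \<open>Finite and infinite frequencies are treated alike, as entrywise maps
    \<open>f\<close> from transfer functions to complex numbers that send 0 to 0.\<close>
  have det: "det (1\<^sub>m m + complex_of_real \<tau> \<cdot>\<^sub>m (map_mat complex_of_real H * map_mat f G)) \<noteq> 0"
    if "f 0 = 0" "0 \<le> \<tau>" "\<tau> \<le> 1"
      "gain_condition (map (map_mat f) Gs) (map_mat complex_of_real H)
        \<or> phase_condition (map (map_mat f) Gs) \<or> xz_condition (map (map_mat f) Gs) (map_mat complex_of_real H)"
    for f :: "tf \<Rightarrow> complex" and \<tau>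
    unfolding blocks(1) map_mat_diag_block_mat[of f, OF that(1)]
    by (rule conditions_det_nonzero) (use that blocks m H in \<open>auto simp: o_def\<close>)
  show "det (1\<^sub>m m + complex_of_real \<tau> \<cdot>\<^sub>m (map_mat complex_of_real H * freq_response G \<omega>)) \<noteq> 0"
    if "0 \<le> \<omega>" "0 \<le> \<tau>" "\<tau> \<le> 1" for \<omega> \<tau>
    unfolding freq_response_def
    by (rule det) (use finite_freq that in \<open>auto simp: tf_eval_def tf_num_def freq_response_def[abs_def]\<close>)
  show "det (1\<^sub>m m + complex_of_real \<tau> \<cdot>\<^sub>m (map_mat complex_of_real H * freq_response_infinity G)) \<noteq> 0"
    if "0 \<le> \<tau>" "\<tau> \<le> 1" for \<tau>
    unfolding freq_response_infinity_def
    by (rule det) (use infinite_freq that in \<open>auto simp: tf_at_infinity_def tf_num_def freq_response_infinity_def[abs_def]\<close>)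
qed

end
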